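(* Let $K$ be a countably infinite field, $p(x)\in K[x]$ a non-constant polynomial which is admissible for $K$, and $(F_N)_{N\in\mathbb{N}}$ a double F\o lner sequence in $K$. Let $E\subset K$ with $\overline{d}_{(F_N)}(E)>0$. Then for any $\epsilon>0$, $$\underline{d}_{(F_N)}\Big(\big\{u\in K^*:\ \overline{d}_{(F_N)}\big((E-p(u))\cap(E/u)\big)\ \ge\ (\overline{d}_{(F_N)}(E))^2-\epsilon\big\}\Big)>0 .$$
   Context: For a countable field $K$, $K^*=K\setminus\{0\}$. A double F\o lner sequence in $K$ is a sequence $(F_N)_{N\in\mathbb{N}}$ of non-empty finite subsets of $K$ such that for every $x\in K^*$, $\lim_{N\to\infty}\frac{|F_N\cap(x+F_N)|}{|F_N|}=\lim_{N\to\infty}\frac{|F_N\cap(xF_N)|}{|F_N|}=1$. For $E\subset K$, $\overline{d}_{(F_N)}(E)=\limsup_{N\to\infty}\frac{|E\cap F_N|}{|F_N|}$ and $\underline{d}_{(F_N)}(E)=\liminf_{N\to\infty}\frac{|E\cap F_N|}{|F_N|}$. For $u\in K^*$, $E-p(u)=\{v\in K: v+p(u)\in E\}$ and $E/u=\{v\in K: uv\in E\}$. A non-constant polynomial $p(x)\in K[x]$ is admissible for $K$ if either $\operatorname{char}(K)=0$, or $\operatorname{char}(K)=q$ is prime and $\deg(p(x))\le q-1$. *)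

theory Defs
  imports "HOL-Analysis.Analysis" "HOL-Computational_Algebra.Computational_Algebra"
begin

definition double_Folner :: "(nat \<Rightarrow> 'a::field set) \<Rightarrow> bool" where
  "double_Folner F \<longleftrightarrow>
     (\<forall>N. finite (F N) \<and> F N \<noteq> {}) \<and>
     (\<forall>x. x \<noteq> 0 \<longrightarrow>
        (\<lambda>N. real (card (F N \<inter> (\<lambda>y. x + y) ` F N)) / real (card (F N))) \<longlonglongrightarrow> 1 \<and>
        (\<lambda>N. real (card (F N \<inter> (\<lambda>y. x * y) ` F N)) / real (card (F N))) \<longlonglongrightarrow> 1)"

text \<open>
  The limits superior and inferior are formed in the complete lattice of extended reals. For
  finite averaging sets they lie in \<open>[0, 1]\<close>, so converting back to the reals loses nothing;
  see \<open>ereal_upper_density\<close> and \<open>ereal_lower_density\<close> below.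
\<close>

definition upper_density :: "(nat \<Rightarrow> 'a set) \<Rightarrow> 'a set \<Rightarrow> real" where
  "upper_density F E =
     real_of_ereal (limsup (\<lambda>N. ereal (real (card (E \<inter> F N)) / real (card (F N)))))"

definition lower_density :: "(nat \<Rightarrow> 'a set) \<Rightarrow> 'a set \<Rightarrow> real" where
  "lower_density F E =
     real_of_ereal (liminf (\<lambda>N. ereal (real (card (E \<inter> F N)) / real (card (F N)))))"

lemma relative_density_bounds:
  assumes "finite A"
  shows "0 \<le> real (card (E \<inter> A)) / real (card A)" "real (card (E \<inter> A)) / real (card A) \<le> 1"
proof -
  have "card (E \<inter> A) \<le> card A"
    using assms by (intro card_mono) auto
  then show "real (card (E \<inter> A)) / real (card A) \<le> 1"
    by (intro divide_le_eq_1[THEN iffD2]) linarith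
qed simp

lemma ereal_upper_density:
  assumes "\<And>N. finite (F N)"
  shows "ereal (upper_density F E) =
           limsup (\<lambda>N. ereal (real (card (E \<inter> F N)) / real (card (F N))))"
proof -
  let ?f = "\<lambda>N. ereal (real (card (E \<inter> F N)) / real (card (F N)))"
  have "0 \<le> limsup ?f"
    by (intro le_Limsup always_eventually) auto
  moreover have "limsup ?f \<le> 1"
    using relative_density_bounds(2)[OF assms]
    by (intro Limsup_bounded always_eventually) (auto simp: one_ereal_def)
  ultimately have "\<bar>limsup ?f\<bar> \<noteq> \<infinity>"
    by auto
  then show ?thesis
    unfolding upper_density_def by (rule ereal_real')
qed

lemma ereal_lower_density:
  assumes "\<And>N. finite (F N)"
  shows "ereal (lower_density F E) =
           liminf (\<lambda>N. ereal (real (card (E \<inter> F N)) / real (card (F N))))"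
proof -
  let ?f = "\<lambda>N. ereal (real (card (E \<inter> F N)) / real (card (F N)))"
  have "0 \<le> liminf ?f"
    by (intro Liminf_bounded always_eventually) auto
  moreover have "liminf ?f \<le> 1"
    using relative_density_bounds(2)[OF assms]
    by (intro Liminf_le always_eventually) (auto simp: one_ereal_def)
  ultimately have "\<bar>liminf ?f\<bar> \<noteq> \<infinity>"
    by auto
  then show ?thesis
    unfolding lower_density_def by (rule ereal_real')
qed

definition set_shift :: "'a::field set \<Rightarrow> 'a \<Rightarrow> 'a set" where
  "set_shift E x = {v. v + x \<in> E}"

text \<open>This is $E/u$; it is meant for nonzero \<open>u\<close>.\<close>
definition set_quot :: "'a::field set \<Rightarrow> 'a \<Rightarrow> 'a set" where
  "set_quot E u = {v. u * v \<in> E}"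

definition admissible :: "'a::field poly \<Rightarrow> bool" where
  "admissible p \<longleftrightarrow>
     degree p > 0 \<and> (CHAR('a) = 0 \<or> (prime CHAR('a) \<and> degree p \<le> CHAR('a) - 1))"

end

theory Submission
  imports Defs
begin


text \<open>
  Write $d$ for the upper density of $E$ and $f$ for its indicator function. Densities are replaced by
  a mean $m$ on bounded functions on the field: a limit, along a filter, of the averages over $F_N$. It
  is invariant under all maps $v \mapsto av + b$ with $a \neq 0$, gives $E$ the mean $d$ exactly, and
  never exceeds the upper density (\<open>affine_mean_of_density\<close>). With
  \[ \varphi(u) = m\big(v \mapsto f(v/u + p(u))\, f(v)\big), \]
  the substitution $v \mapsto uv$ shows that $\varphi(u)$ is at most the upper density of
  $(E - p(u)) \cap E/u$. It therefore suffices that the averages of $\varphi$ over $F_N$ are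
  eventually at least $d^2 - \epsilon/4$ (\<open>average_lower_bound\<close>): as $\varphi \le 1$, this forces a
  set of $u$ of positive lower density on which $\varphi(u) \ge d^2 - \epsilon$.

  In a Hilbert space one would project $f$ to the functions invariant under translations, and then
  under dilations. Bounded functions with the form $\langle x, y\rangle = m(xy)$ are not complete, so
  the projection is replaced by a nearly shortest function $g$ in the set generated from the
  translates of $f$ by forming midpoints. The parallelogram identity makes such a $g$ almost invariant
  under all translations, \<^emph>\<open>uniformly\<close> in the translation (\<open>nearly_invariant_point\<close>). A second
  such step with dilations leads from $g$ to an almost dilation invariant $k$.

  The difference $f - g$ is a combination of coboundaries $f - f(\cdot + s)$, and it contributes nothing
  to the averages of $\varphi$. This is the arithmetic core. The van der Corput inequality for the
  translations $u \mapsto u + b$ lowers the degree of a polynomial by exactly one, the characteristic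
  being $0$ or larger than the degree, until a linear polynomial is left, for which the F\o lner
  property suffices (\<open>linearly_null_polynomially_null\<close>). The van der Corput inequality for the
  dilations $u \mapsto bu$ reduces the averages of $(f-g)(v/u + p(u))$ to this case
  (\<open>linearly_null_affine_null\<close>). The rest is
  $\langle g(\cdot/u + p(u)), f\rangle \approx \langle g(\cdot/u), f\rangle
   \approx \langle g(\cdot/u), g\rangle$, the average of which is approximately
  $\langle k, g\rangle \approx \langle k, k\rangle \ge m(k)^2 = m(f)^2 = d^2$.
\<close>

section \<open>Averages over finite sets\<close>

lemma tendsto_0_dominated:
  fixes x e :: "nat \<Rightarrow> real"
  assumes "e \<longlonglongrightarrow> 0" "\<And>N. \<bar>x N\<bar> \<le> e N"
  shows "x \<longlonglongrightarrow> 0"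
  using assms by (intro Lim_null_comparison[of x e]) (auto intro: always_eventually)

definition avg :: "'b set \<Rightarrow> ('b \<Rightarrow> real) \<Rightarrow> real" where
  "avg S x = (\<Sum>u\<in>S. x u) / real (card S)"

lemma avg_add: "avg S (\<lambda>u. x u + y u) = avg S x + avg S y"
  by (simp add: avg_def sum.distrib add_divide_distrib)

lemma avg_diff: "avg S (\<lambda>u. x u - y u) = avg S x - avg S y"
  by (simp add: avg_def sum_subtractf diff_divide_distrib)

lemma avg_scale: "avg S (\<lambda>u. c * x u) = c * avg S x"
  by (simp add: avg_def sum_distrib_left)

lemma avg_sum: "avg S (\<lambda>u. \<Sum>i\<in>I. x i u) = (\<Sum>i\<in>I. avg S (\<lambda>u. x i u))"
  unfolding avg_def sum_divide_distrib[symmetric] by (subst sum.swap) simp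

lemma avg_const: "finite S \<Longrightarrow> S \<noteq> {} \<Longrightarrow> avg S (\<lambda>u. c) = c"
  by (simp add: avg_def)

lemma avg_mono: "(\<And>u. u \<in> S \<Longrightarrow> x u \<le> y u) \<Longrightarrow> avg S x \<le> avg S y"
  unfolding avg_def by (intro divide_right_mono sum_mono) auto

lemma avg_cong: "(\<And>u. u \<in> S \<Longrightarrow> x u = y u) \<Longrightarrow> avg S x = avg S y"
  unfolding avg_def by (simp cong: sum.cong)

lemma avg_abs_le:
  assumes "finite S" "S \<noteq> {}" "\<And>u. u \<in> S \<Longrightarrow> \<bar>x u\<bar> \<le> C"
  shows "\<bar>avg S x\<bar> \<le> C"
proof -
  have "avg S x \<le> avg S (\<lambda>u. C)" "avg S (\<lambda>u. - C) \<le> avg S x"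
    using assms(3) by (intro avg_mono; force)+
  then show ?thesis
    using avg_const[OF assms(1,2)] by (auto simp: abs_le_iff)
qed

lemma avg_squared_le:
  assumes "finite S" "S \<noteq> {}"
  shows "(avg S x)\<^sup>2 \<le> avg S (\<lambda>u. (x u)\<^sup>2)"
proof -
  \<comment> \<open>the variance is nonnegative\<close>
  define c where "c = avg S x"
  have "0 \<le> avg S (\<lambda>u. (x u - c)\<^sup>2)"
    unfolding avg_def by (intro divide_nonneg_nonneg sum_nonneg) auto
  also have "avg S (\<lambda>u. (x u - c)\<^sup>2) = avg S (\<lambda>u. ((x u)\<^sup>2 + c\<^sup>2) - (2 * c) * x u)"
    by (simp add: power2_diff algebra_simps)
  also have "\<dots> = avg S (\<lambda>u. (x u)\<^sup>2) + c\<^sup>2 - 2 * c * c"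
    by (simp only: avg_diff avg_add avg_scale avg_const[OF assms] c_def)
  finally show ?thesis
    by (simp add: c_def power2_eq_square)
qed

lemma avg_swap: "avg S (\<lambda>u. avg T (\<lambda>b. x u b)) = avg T (\<lambda>b. avg S (\<lambda>u. x u b))"
  unfolding avg_def sum_divide_distrib[symmetric]
  by (subst sum.swap) (simp add: mult.commute)

text \<open>
  The two sums cancel on \<open>S \<inter> \<tau> ` S\<close>, and the two remaining sets have the same size because \<open>\<tau>\<close> is
  injective.
\<close>
lemma avg_reparametrise:
  assumes S: "finite S" "S \<noteq> {}" and \<tau>: "inj_on \<tau> S" and C: "\<And>w. \<bar>x w\<bar> \<le> C"
  shows "\<bar>avg S (\<lambda>u. x (\<tau> u)) - avg S x\<bar>
           \<le> 2 * C * (1 - real (card (S \<inter> \<tau> ` S)) / real (card S))"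
proof -
  have cS: "real (card S) > 0"
    using S by (simp add: card_gt_0_iff)
  have bnd: "\<bar>sum x A\<bar> \<le> C * real (card A)" for A
    using sum_norm_bound[of A x C] C by (simp add: mult.commute)
  have ct: "card (\<tau> ` S) = card S"
    using \<tau> by (rule card_image)
  have c1: "real (card (\<tau> ` S - S)) = real (card S) - real (card (S \<inter> \<tau> ` S))"
    using card_Diff_subset_Int[of "\<tau> ` S" S] S card_mono[of S "S \<inter> \<tau> ` S"]
    by (simp add: ct Int_commute of_nat_diff)
  have c2: "real (card (S - \<tau> ` S)) = real (card S) - real (card (S \<inter> \<tau> ` S))"
    using card_Diff_subset_Int[of S "\<tau> ` S"] S card_mono[of S "S \<inter> \<tau> ` S"]
    by (simp add: of_nat_diff)
  have "(\<Sum>u\<in>S. x (\<tau> u)) = sum x (\<tau> ` S)"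
    using \<tau> by (simp add: sum.reindex)
  also have "\<dots> = sum x (\<tau> ` S - S) + sum x (S \<inter> \<tau> ` S)"
    using S by (simp add: sum.Int_Diff[of "\<tau> ` S" x S] Int_commute)
  finally have e1: "(\<Sum>u\<in>S. x (\<tau> u)) = sum x (\<tau> ` S - S) + sum x (S \<inter> \<tau> ` S)" .
  have e2: "sum x S = sum x (S - \<tau> ` S) + sum x (S \<inter> \<tau> ` S)"
    using S by (simp add: sum.Int_Diff[of S x "\<tau> ` S"])
  have "\<bar>(\<Sum>u\<in>S. x (\<tau> u)) - sum x S\<bar> \<le> 2 * C * (real (card S) - real (card (S \<inter> \<tau> ` S)))"
    using bnd[of "\<tau> ` S - S"] bnd[of "S - \<tau> ` S"] unfolding e1 e2 c1 c2
    by (simp add: abs_le_iff algebra_simps)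
  then have "\<bar>(\<Sum>u\<in>S. x (\<tau> u)) - sum x S\<bar> / real (card S)
       \<le> 2 * C * (real (card S) - real (card (S \<inter> \<tau> ` S))) / real (card S)"
    by (intro divide_right_mono) auto
  then show ?thesis
    using cS by (simp add: avg_def diff_divide_distrib[symmetric] abs_divide) (simp add: field_simps)
qed

section \<open>Affinely invariant means on bounded functions\<close>

definition bdd :: "('b \<Rightarrow> real) \<Rightarrow> bool" where
  "bdd f \<longleftrightarrow> (\<exists>C. \<forall>v. \<bar>f v\<bar> \<le> C)"

lemma bddI: "(\<And>v. \<bar>f v\<bar> \<le> C) \<Longrightarrow> bdd f"
  unfolding bdd_def by blast

lemma bddE:
  assumes "bdd f" obtains C where "C \<ge> 0" "\<And>v. \<bar>f v\<bar> \<le> C"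
  using assms unfolding bdd_def by (meson abs_ge_zero order_trans)

named_theorems bdd_intros

lemma bdd_const [bdd_intros]: "bdd (\<lambda>v. c)"
  by (rule bddI[of _ "\<bar>c\<bar>"]) simp

lemma bdd_comp: "bdd f \<Longrightarrow> bdd (\<lambda>v. f (\<sigma> v))"
  unfolding bdd_def by blast

lemma bdd_add [bdd_intros]: "bdd f \<Longrightarrow> bdd g \<Longrightarrow> bdd (\<lambda>v. f v + g v)"
  by (elim bddE, rule bddI) (rule order_trans[OF abs_triangle_ineq add_mono]; blast)

lemma bdd_mult [bdd_intros]: "bdd f \<Longrightarrow> bdd g \<Longrightarrow> bdd (\<lambda>v. f v * g v)"
  by (elim bddE, rule bddI) (simp only: abs_mult, rule mult_mono; force)

lemma bdd_diff [bdd_intros]: "bdd f \<Longrightarrow> bdd g \<Longrightarrow> bdd (\<lambda>v. f v - g v)"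
  using bdd_add[of f "\<lambda>v. (-1) * g v"] bdd_mult[OF bdd_const[of "-1"], of g] by simp

lemma bdd_divide [bdd_intros]: "bdd f \<Longrightarrow> bdd (\<lambda>v. f v / c)"
  using bdd_mult[OF _ bdd_const[of "1 / c"]] by simp

lemma bdd_power2 [bdd_intros]: "bdd f \<Longrightarrow> bdd (\<lambda>v. (f v)\<^sup>2)"
  unfolding power2_eq_square by (intro bdd_intros)

lemma bdd_sum [bdd_intros]: "(\<And>i. i \<in> I \<Longrightarrow> bdd (f i)) \<Longrightarrow> bdd (\<lambda>v. \<Sum>i\<in>I. f i v)"
  by (induction I rule: infinite_finite_induct) (auto intro!: bdd_intros)

lemma bdd_avg [bdd_intros]: "(\<And>i. i \<in> I \<Longrightarrow> bdd (f i)) \<Longrightarrow> bdd (\<lambda>v. avg I (\<lambda>i. f i v))"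
  unfolding avg_def by (intro bdd_intros)

locale affine_mean =
  fixes m :: "('a::field \<Rightarrow> real) \<Rightarrow> real"
  assumes m_add: "bdd f \<Longrightarrow> bdd g \<Longrightarrow> m (\<lambda>v. f v + g v) = m f + m g"
    and m_scale: "bdd f \<Longrightarrow> m (\<lambda>v. c * f v) = c * m f"
    and m_nonneg: "bdd f \<Longrightarrow> (\<And>v. 0 \<le> f v) \<Longrightarrow> 0 \<le> m f"
    and m_one: "m (\<lambda>v. 1) = 1"
    and m_affine: "bdd f \<Longrightarrow> a \<noteq> 0 \<Longrightarrow> m (\<lambda>v. f (a * v + b)) = m f"
begin

lemma m_const: "m (\<lambda>v. c) = c"
  using m_scale[OF bdd_const[of 1], of c] m_one by simp

lemma m_diff: "bdd f \<Longrightarrow> bdd g \<Longrightarrow> m (\<lambda>v. f v - g v) = m f - m g"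
  using m_add[of f "\<lambda>v. (-1) * g v"] m_scale[of g "-1"] bdd_mult[OF bdd_const[of "-1"], of g]
  by simp

lemma m_mono:
  assumes "bdd f" "bdd g" "\<And>v. f v \<le> g v" shows "m f \<le> m g"
  using m_nonneg[of "\<lambda>v. g v - f v"] m_diff[OF assms(2,1)] assms by (simp add: bdd_diff)

lemma m_abs_le:
  assumes "\<And>v. \<bar>f v\<bar> \<le> C" shows "\<bar>m f\<bar> \<le> C"
  using m_mono[OF bddI[OF assms] bdd_const[of C]] m_mono[OF bdd_const[of "-C"] bddI[OF assms]]
    m_const assms by (simp add: abs_le_iff minus_le_iff)

lemma m_sum:
  "(\<And>i. i \<in> I \<Longrightarrow> bdd (f i)) \<Longrightarrow> m (\<lambda>v. \<Sum>i\<in>I. f i v) = (\<Sum>i\<in>I. m (f i))"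
  by (induction I rule: infinite_finite_induct) (auto simp: m_const m_add bdd_sum)

lemma m_avg:
  assumes "\<And>i. i \<in> I \<Longrightarrow> bdd (f i)"
  shows "m (\<lambda>v. avg I (\<lambda>i. f i v)) = avg I (\<lambda>i. m (f i))"
proof -
  have "m (\<lambda>v. (1 / real (card I)) * (\<Sum>i\<in>I. f i v)) = (1 / real (card I)) * (\<Sum>i\<in>I. m (f i))"
    using assms by (subst m_scale) (auto intro!: bdd_intros simp: m_sum)
  then show ?thesis
    by (simp add: avg_def)
qed

lemma m_scale_add_const: "bdd f \<Longrightarrow> m (\<lambda>v. c * f v + d) = c * m f + d"
  using m_add[of "\<lambda>v. c * f v" "\<lambda>v. d"] by (simp add: m_scale m_const bdd_intros)

lemma m_translate: "bdd f \<Longrightarrow> m (\<lambda>v. f (v + b)) = m f"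
  using m_affine[of f 1 b] by simp

lemma m_dilate: "bdd f \<Longrightarrow> a \<noteq> 0 \<Longrightarrow> m (\<lambda>v. f (a * v)) = m f"
  using m_affine[of f a 0] by simp

lemma m_squared_le:
  assumes f: "bdd f" shows "(m f)\<^sup>2 \<le> m (\<lambda>v. (f v)\<^sup>2)"
proof -
  define c where "c = m f"
  have "0 \<le> m (\<lambda>v. (f v - c)\<^sup>2)"
    using f by (intro m_nonneg bdd_intros) auto
  also have "(\<lambda>v. (f v - c)\<^sup>2) = (\<lambda>v. ((f v)\<^sup>2 + c\<^sup>2) - (2 * c) * f v)"
    by (simp add: power2_diff algebra_simps)
  also have "m \<dots> = m (\<lambda>v. (f v)\<^sup>2 + c\<^sup>2) - m (\<lambda>v. (2 * c) * f v)"
    using f by (intro m_diff bdd_intros)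
  also have "\<dots> = m (\<lambda>v. (f v)\<^sup>2) + c\<^sup>2 - (2 * c) * m f"
    using f by (simp only: m_add m_scale m_const bdd_intros)
  finally show ?thesis
    by (simp add: c_def power2_eq_square)
qed

text \<open>
  Since one factor is always bounded here, this follows from the variance inequality
  \<open>m_squared_le\<close> and takes the place of the Cauchy--Schwarz inequality.
\<close>
lemma m_mult_squared_le:
  assumes f: "bdd f" and g: "\<And>v. \<bar>g v\<bar> \<le> K"
  shows "(m (\<lambda>v. f v * g v))\<^sup>2 \<le> K\<^sup>2 * m (\<lambda>v. (f v)\<^sup>2)"
proof -
  have bg: "bdd g" using g by (rule bddI)
  have "(m (\<lambda>v. f v * g v))\<^sup>2 \<le> m (\<lambda>v. (f v * g v)\<^sup>2)"
    using f bg by (intro m_squared_le bdd_intros)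
  also have "\<dots> \<le> m (\<lambda>v. K\<^sup>2 * (f v)\<^sup>2)"
  proof (rule m_mono)
    fix v
    have "(g v)\<^sup>2 \<le> K\<^sup>2"
      using g[of v] by (metis abs_ge_zero power2_abs power_mono)
    then show "(f v * g v)\<^sup>2 \<le> K\<^sup>2 * (f v)\<^sup>2"
      by (simp add: power_mult_distrib mult.commute[of "K\<^sup>2"] mult_left_mono)
  qed (use f bg in \<open>auto intro!: bdd_intros\<close>)
  also have "\<dots> = K\<^sup>2 * m (\<lambda>v. (f v)\<^sup>2)"
    using f by (intro m_scale bdd_intros)
  finally show ?thesis .
qed

lemma m_mult_small:
  assumes "bdd f" "\<And>v. \<bar>g v\<bar> \<le> 1" "m (\<lambda>v. (f v)\<^sup>2) \<le> \<eta>\<^sup>2" "0 \<le> \<eta>"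
  shows "\<bar>m (\<lambda>v. f v * g v)\<bar> \<le> \<eta>"
proof -
  have "(m (\<lambda>v. f v * g v))\<^sup>2 \<le> \<eta>\<^sup>2"
    using m_mult_squared_le[of f g 1] assms by simp
  then show ?thesis
    using assms(4) by (simp add: abs_le_square_iff[symmetric])
qed

end

section \<open>Averages along a double Folner sequence\<close>

text \<open>
  If \<open>card (F N) < k\<close>, then an invariance ratio above \<open>1 - 1 / k\<close> already means exact invariance. A set
  that is exactly invariant under \<open>k\<close> different translations has at least \<open>k\<close> elements.
\<close>
lemma double_Folner_card_at_top:
  fixes F :: "nat \<Rightarrow> 'a::field set"
  assumes "double_Folner F" "infinite (UNIV :: 'a set)"
  shows "filterlim (\<lambda>N. real (card (F N))) at_top sequentially"
  unfolding filterlim_at_top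
proof
  fix Z :: real
  define k where "k = Suc (nat \<lceil>Z\<rceil>)"
  obtain X :: "'a set" where X: "finite X" "card X = k"
    using infinite_arbitrarily_large[OF assms(2)] by metis
  have F: "finite (F N)" "F N \<noteq> {}" for N
    using assms(1) by (auto simp: double_Folner_def)
  have "\<forall>\<^sub>F N in sequentially. \<forall>x\<in>X - {0}.
      real (card (F N \<inter> (\<lambda>y. x + y) ` F N)) / real (card (F N)) > 1 - 1 / real k"
    using X(1) assms(1)
    by (intro eventually_ball_finite ballI) (auto simp: double_Folner_def k_def intro!: order_tendstoD(1))
  then show "\<forall>\<^sub>F N in sequentially. Z \<le> real (card (F N))"
  proof eventually_elim
    case (elim N)
    show ?case
    proof (rule ccontr)
      assume "\<not> Z \<le> real (card (F N))"
      then have less: "card (F N) < k"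
        unfolding k_def by linarith
      have pos: "card (F N) > 0"
        using F by (simp add: card_gt_0_iff)
      obtain y where y: "y \<in> F N"
        using F by blast
      have "x + y \<in> F N" if x: "x \<in> X" "x \<noteq> 0" for x
      proof -
        have "real (card (F N)) / k \<le> 1"
          using less by simp
        then have "real (card (F N)) - 1 \<le> (1 - 1 / k) * real (card (F N))"
          by (simp add: algebra_simps)
        also have "\<dots> < real (card (F N \<inter> (\<lambda>y. x + y) ` F N))"
          using elim x pos by (simp add: pos_less_divide_eq)
        finally have "card (F N) \<le> card (F N \<inter> (\<lambda>y. x + y) ` F N)"
          by linarith
        moreover have "card ((\<lambda>y. x + y) ` F N) = card (F N)"
          by (simp add: card_image)
        ultimately have "F N \<inter> (\<lambda>y. x + y) ` F N = (\<lambda>y. x + y) ` F N"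
          using F by (intro card_seteq) auto
        then show ?thesis using y by blast
      qed
      then have "(\<lambda>x. x + y) ` X \<subseteq> F N"
      proof (intro image_subsetI)
        fix x assume "x \<in> X"
        then show "x + y \<in> F N"
          using y \<open>\<And>x. x \<in> X \<Longrightarrow> x \<noteq> 0 \<Longrightarrow> x + y \<in> F N\<close> by (cases "x = 0") auto
      qed
      then have "card ((\<lambda>x. x + y) ` X) \<le> card (F N)"
        using F by (intro card_mono)
      then show False
        using less X by (simp add: card_image)
    qed
  qed
qed

definition asymp_invariant :: "(nat \<Rightarrow> 'b set) \<Rightarrow> ('b \<Rightarrow> 'b) \<Rightarrow> bool" where
  "asymp_invariant F \<tau> \<longleftrightarrow>
     inj \<tau> \<and> (\<lambda>N. real (card (F N \<inter> \<tau> ` F N)) / real (card (F N))) \<longlonglongrightarrow> 1"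

lemma asymp_invariant_translation:
  assumes "double_Folner F" shows "asymp_invariant F (\<lambda>u. u + b)"
proof (cases "b = 0")
  case False
  then show ?thesis
    using assms by (auto simp: asymp_invariant_def double_Folner_def inj_def add.commute[of _ b])
next
  case True
  then show ?thesis
    using assms by (auto simp: asymp_invariant_def double_Folner_def)
qed

lemma asymp_invariant_dilation:
  "double_Folner F \<Longrightarrow> c \<noteq> 0 \<Longrightarrow> asymp_invariant F (\<lambda>u. c * u)"
  by (auto simp: asymp_invariant_def double_Folner_def inj_def)

text \<open>
  The error \<open>e\<close> depends only on the bound \<open>C\<close>. Families of functions \<open>x\<close> indexed by a point \<open>v\<close> of
  the field are later handled uniformly in \<open>v\<close>, which is what allows a mean to be applied afterwards.
\<close>
lemma avg_reparam_uniform: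
  assumes \<tau>: "asymp_invariant F \<tau>" and F: "\<And>N. finite (F N)" "\<And>N. F N \<noteq> {}"
  obtains e where "e \<longlonglongrightarrow> 0" "\<And>N. 0 \<le> e N"
    "\<And>N x. (\<And>u. \<bar>x u\<bar> \<le> C) \<Longrightarrow> \<bar>avg (F N) (\<lambda>u. x (\<tau> u)) - avg (F N) x\<bar> \<le> e N"
proof
  let ?e = "\<lambda>N. 2 * \<bar>C\<bar> * (1 - real (card (F N \<inter> \<tau> ` F N)) / real (card (F N)))"
  have "?e \<longlonglongrightarrow> 2 * \<bar>C\<bar> * (1 - 1)"
    using \<tau> unfolding asymp_invariant_def by (intro tendsto_intros) auto
  then show "?e \<longlonglongrightarrow> 0" by simp
  show "0 \<le> ?e N" for N
    using F by (simp add: divide_le_eq_1 card_mono card_gt_0_iff)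
  show "\<bar>avg (F N) (\<lambda>u. x (\<tau> u)) - avg (F N) x\<bar> \<le> ?e N" if "\<And>u. \<bar>x u\<bar> \<le> C" for N x
    using \<tau> that F unfolding asymp_invariant_def
    by (intro avg_reparametrise) (auto intro: inj_on_subset order_trans[OF _ abs_ge_self])
qed

locale affine_mean_folner = affine_mean m for m :: "('a::field \<Rightarrow> real) \<Rightarrow> real" +
  fixes F :: "nat \<Rightarrow> 'a set"
  assumes folner: "double_Folner F" and infinite_field: "infinite (UNIV :: 'a set)"
begin

lemma F_finite [simp]: "finite (F N)" and F_nonempty [simp]: "F N \<noteq> {}"
  using folner by (auto simp: double_Folner_def)

text \<open>
  The value at \<open>0\<close>, where dilation by \<open>u\<close> is not invertible and \<open>v / u\<close> is \<open>0\<close>, does not influence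
  the limit of averages.
\<close>
lemma avg_off_zero:
  assumes "\<And>u. \<bar>x u\<bar> \<le> C" "\<And>u. \<bar>y u\<bar> \<le> C" "\<And>u. u \<noteq> 0 \<Longrightarrow> x u = y u"
    and y: "(\<lambda>N. avg (F N) y) \<longlonglongrightarrow> l"
  shows "(\<lambda>N. avg (F N) x) \<longlonglongrightarrow> l"
proof -
  have "\<bar>avg (F N) x - avg (F N) y\<bar> \<le> 2 * C / real (card (F N))" for N
  proof -
    have "\<bar>\<Sum>u\<in>F N. x u - y u\<bar> \<le> (\<Sum>u\<in>F N. if u = 0 then 2 * C else 0)"
      using assms(1,2)[of 0] assms(3) by (intro order_trans[OF sum_abs sum_mono]) auto
    also have "\<dots> \<le> 2 * C"
      using assms(1)[of 0] by (simp add: sum.delta)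
    finally show ?thesis
      unfolding avg_diff[symmetric] unfolding avg_def by (simp add: divide_right_mono)
  qed
  moreover have "(\<lambda>N. 2 * C / real (card (F N))) \<longlonglongrightarrow> 0"
    using double_Folner_card_at_top[OF folner infinite_field]
    by (intro tendsto_divide_0[OF tendsto_const] filterlim_at_top_imp_at_infinity)
  ultimately have "(\<lambda>N. avg (F N) x - avg (F N) y) \<longlonglongrightarrow> 0"
    by (intro Lim_null_comparison[of "\<lambda>N. avg (F N) x - avg (F N) y"]) (auto intro: always_eventually)
  from tendsto_add[OF this y] show ?thesis by simp
qed

section \<open>The van der Corput inequality\<close>

text \<open>
  Convergence to zero of the averages in the norm of $L^2(m)$, the sense in which mean ergodic theorems
  hold.
\<close>
definition null_average :: "('a \<Rightarrow> 'a \<Rightarrow> real) \<Rightarrow> bool" where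
  "null_average a \<longleftrightarrow> (\<lambda>N. m (\<lambda>v. (avg (F N) (\<lambda>u. a u v))\<^sup>2)) \<longlonglongrightarrow> 0"

lemma m_square_nonneg: "(\<And>u. bdd (a u)) \<Longrightarrow> 0 \<le> m (\<lambda>v. (avg S (\<lambda>u. a u v))\<^sup>2)"
  by (intro m_nonneg bdd_intros) auto

text \<open>
  The averages of \<open>a u\<close> change little when \<open>u\<close> is replaced by the mean over finitely many \<open>\<tau> b u\<close>. By
  convexity the square of the new average is at most an average of pair correlations. With \<open>n\<close> values
  of \<open>b\<close>, the \<open>n\<close> diagonal pairs contribute at most \<open>n * C\<^sup>2 / n\<^sup>2\<close>, and the other pairs tend to \<open>0\<close>. All
  estimates before the application of \<open>m\<close> hold at each point \<open>v\<close>.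
\<close>
lemma van_der_Corput:
  assumes C: "\<And>u v. \<bar>a u v\<bar> \<le> C" and B: "infinite B"
    and \<tau>: "\<And>b. b \<in> B \<Longrightarrow> asymp_invariant F (\<tau> b)"
    and corr: "\<And>b c. b \<in> B \<Longrightarrow> c \<in> B \<Longrightarrow> b \<noteq> c \<Longrightarrow>
      (\<lambda>N. avg (F N) (\<lambda>u. m (\<lambda>v. a (\<tau> b u) v * a (\<tau> c u) v))) \<longlonglongrightarrow> 0"
  shows "null_average a"
proof -
  have ba: "bdd (a u)" for u
    using C by (rule bddI)
  have C0: "C \<ge> 0"
    using C[of undefined undefined] by linarith
  have "\<forall>b\<in>B. \<exists>e. e \<longlonglongrightarrow> 0 \<and> (\<forall>N. 0 \<le> e N) \<and>
     (\<forall>N x. (\<forall>u. \<bar>x u\<bar> \<le> C) \<longrightarrow> \<bar>avg (F N) (\<lambda>u. x (\<tau> b u)) - avg (F N) x\<bar> \<le> e N)"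
  proof
    fix b assume "b \<in> B"
    then obtain e where "e \<longlonglongrightarrow> 0" "\<And>N. 0 \<le> e N"
      "\<And>N x. (\<And>u. \<bar>x u\<bar> \<le> C) \<Longrightarrow> \<bar>avg (F N) (\<lambda>u. x (\<tau> b u)) - avg (F N) x\<bar> \<le> e N"
      using avg_reparam_uniform[OF \<tau> F_finite F_nonempty, of b C] by blast
    then show "\<exists>e. e \<longlonglongrightarrow> 0 \<and> (\<forall>N. 0 \<le> e N) \<and>
     (\<forall>N x. (\<forall>u. \<bar>x u\<bar> \<le> C) \<longrightarrow> \<bar>avg (F N) (\<lambda>u. x (\<tau> b u)) - avg (F N) x\<bar> \<le> e N)"
      by (intro exI[of _ e]) auto
  qed
  from bchoice[OF this] obtain e where e: "\<And>b. b \<in> B \<Longrightarrow> e b \<longlonglongrightarrow> 0" "\<And>b N. b \<in> B \<Longrightarrow> 0 \<le> e b N"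
    "\<And>b N x. b \<in> B \<Longrightarrow> (\<And>u. \<bar>x u\<bar> \<le> C) \<Longrightarrow>
        \<bar>avg (F N) (\<lambda>u. x (\<tau> b u)) - avg (F N) x\<bar> \<le> e b N"
    by blast
  define D where "D b c N = avg (F N) (\<lambda>u. m (\<lambda>v. a (\<tau> b u) v * a (\<tau> c u) v))" for b c N
  have "\<forall>\<^sub>F N in sequentially. m (\<lambda>v. (avg (F N) (\<lambda>u. a u v))\<^sup>2) < \<epsilon>" if \<epsilon>: "\<epsilon> > 0" for \<epsilon>
  proof -
    obtain n :: nat where n: "2 * C\<^sup>2 / \<epsilon> < real n"
      using reals_Archimedean2 by blast
    have n0: "real n > 0"
      using n \<epsilon> C0 by (smt (verit) divide_nonneg_pos zero_le_power2)
    obtain B' where B': "finite B'" "card B' = n" "B' \<subseteq> B"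
      using infinite_arbitrarily_large[OF B] by metis
    have B'ne: "B' \<noteq> {}"
      using B' n0 by auto
    \<comment> \<open>\<open>\<eta>\<close> bounds the cost of the replacement; the diagonal correlations enter the bound \<open>U\<close>
        through the trivial estimate \<open>C\<^sup>2\<close>, so that \<open>U\<close> converges\<close>
    define \<eta> where "\<eta> N = (\<Sum>b\<in>B'. e b N)" for N
    define U where "U N = 2 * ((\<Sum>b\<in>B'. \<Sum>c\<in>B'. if b = c then C\<^sup>2 else D b c N) / (real n)\<^sup>2)
        + 2 * (\<eta> N)\<^sup>2" for N
    have upper: "m (\<lambda>v. (avg (F N) (\<lambda>u. a u v))\<^sup>2) \<le> U N" for N
    proof -
      define y where "y v = avg B' (\<lambda>b. avg (F N) (\<lambda>u. a (\<tau> b u) v))" for v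
      define z where "z v = avg (F N) (\<lambda>u. (avg B' (\<lambda>b. a (\<tau> b u) v))\<^sup>2)" for v
      have yz: "(y v)\<^sup>2 \<le> z v" for v
        unfolding y_def z_def by (subst avg_swap[symmetric]) (rule avg_squared_le; simp)
      have close: "\<bar>avg (F N) (\<lambda>u. a u v) - y v\<bar> \<le> \<eta> N" for v
      proof -
        have "\<bar>avg (F N) (\<lambda>u. a u v) - avg (F N) (\<lambda>u. a (\<tau> b u) v)\<bar> \<le> \<eta> N" if b: "b \<in> B'" for b
        proof -
          have "\<bar>avg (F N) (\<lambda>u. a u v) - avg (F N) (\<lambda>u. a (\<tau> b u) v)\<bar> \<le> e b N"
            using e(3)[of b "\<lambda>u. a u v" N] b B' C by (auto simp: abs_minus_commute)
          also have "\<dots> \<le> \<eta> N"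
            unfolding \<eta>_def using b B' e(2) by (intro member_le_sum) auto
          finally show ?thesis .
        qed
        then have "\<bar>avg B' (\<lambda>b. avg (F N) (\<lambda>u. a u v) - avg (F N) (\<lambda>u. a (\<tau> b u) v))\<bar> \<le> \<eta> N"
          using B' B'ne by (intro avg_abs_le)
        then show ?thesis
          unfolding avg_diff avg_const[OF B'(1) B'ne] y_def .
      qed
      have "m (\<lambda>v. (avg (F N) (\<lambda>u. a u v))\<^sup>2) \<le> m (\<lambda>v. 2 * z v + 2 * (\<eta> N)\<^sup>2)"
      proof (rule m_mono)
        fix v
        have "(avg (F N) (\<lambda>u. a u v) - y v)\<^sup>2 \<le> (\<eta> N)\<^sup>2"
          using power_mono[OF close[of v] abs_ge_zero, of 2] by simp
        moreover have "s\<^sup>2 \<le> 2 * t\<^sup>2 + 2 * (s - t)\<^sup>2" for s t :: real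
          using zero_le_power2[of "s - 2 * t"] by (simp add: power2_eq_square algebra_simps)
        ultimately show "(avg (F N) (\<lambda>u. a u v))\<^sup>2 \<le> 2 * z v + 2 * (\<eta> N)\<^sup>2"
          using yz[of v] by (smt (verit))
      qed (auto simp: z_def intro!: bdd_intros ba)
      also have "\<dots> = 2 * m z + 2 * (\<eta> N)\<^sup>2"
        by (intro m_scale_add_const) (auto simp: z_def intro!: bdd_intros ba)
      also have "m z = (\<Sum>b\<in>B'. \<Sum>c\<in>B'. D b c N) / (real n)\<^sup>2"
      proof -
        have "m z = avg (F N) (\<lambda>u. m (\<lambda>v. (avg B' (\<lambda>b. a (\<tau> b u) v))\<^sup>2))"
          unfolding z_def by (intro m_avg bdd_intros ba)
        also have "\<dots> = avg (F N) (\<lambda>u. m (\<lambda>v. (1 / (real n)\<^sup>2) * (\<Sum>b\<in>B'. \<Sum>c\<in>B'. a (\<tau> b u) v * a (\<tau> c u) v)))"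
          by (simp add: avg_def power_divide B' power2_eq_square sum_product)
        also have "\<dots> = avg (F N) (\<lambda>u. (1 / (real n)\<^sup>2) * (\<Sum>b\<in>B'. \<Sum>c\<in>B'. m (\<lambda>v. a (\<tau> b u) v * a (\<tau> c u) v)))"
        proof (intro avg_cong)
          fix u
          have "m (\<lambda>v. (1 / (real n)\<^sup>2) * (\<Sum>b\<in>B'. \<Sum>c\<in>B'. a (\<tau> b u) v * a (\<tau> c u) v))
              = (1 / (real n)\<^sup>2) * m (\<lambda>v. \<Sum>b\<in>B'. \<Sum>c\<in>B'. a (\<tau> b u) v * a (\<tau> c u) v)"
            by (intro m_scale bdd_intros ba)
          also have "m (\<lambda>v. \<Sum>b\<in>B'. \<Sum>c\<in>B'. a (\<tau> b u) v * a (\<tau> c u) v)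
              = (\<Sum>b\<in>B'. m (\<lambda>v. \<Sum>c\<in>B'. a (\<tau> b u) v * a (\<tau> c u) v))"
            by (intro m_sum bdd_intros ba)
          also have "\<dots> = (\<Sum>b\<in>B'. \<Sum>c\<in>B'. m (\<lambda>v. a (\<tau> b u) v * a (\<tau> c u) v))"
            by (intro sum.cong refl m_sum bdd_intros ba)
          finally show "m (\<lambda>v. (1 / (real n)\<^sup>2) * (\<Sum>b\<in>B'. \<Sum>c\<in>B'. a (\<tau> b u) v * a (\<tau> c u) v))
              = (1 / (real n)\<^sup>2) * (\<Sum>b\<in>B'. \<Sum>c\<in>B'. m (\<lambda>v. a (\<tau> b u) v * a (\<tau> c u) v))" .
        qed
        also have "\<dots> = (\<Sum>b\<in>B'. \<Sum>c\<in>B'. D b c N) / (real n)\<^sup>2"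
          unfolding avg_scale avg_sum D_def by simp
        finally show ?thesis .
      qed
      also have "(\<Sum>b\<in>B'. \<Sum>c\<in>B'. D b c N) \<le> (\<Sum>b\<in>B'. \<Sum>c\<in>B'. if b = c then C\<^sup>2 else D b c N)"
      proof (intro sum_mono)
        fix b c
        have "D b b N \<le> C\<^sup>2"
        proof -
          have "\<bar>D b b N\<bar> \<le> C\<^sup>2"
            unfolding D_def
          proof (intro avg_abs_le m_abs_le F_finite F_nonempty)
            show "\<bar>a (\<tau> b u) v * a (\<tau> b u) v\<bar> \<le> C\<^sup>2" for u v
              unfolding abs_mult power2_eq_square by (rule mult_mono[OF C C C0 abs_ge_zero])
          qed
          then show ?thesis by simp
        qed
        then show "D b c N \<le> (if b = c then C\<^sup>2 else D b c N)" by auto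
      qed
      finally show ?thesis
        by (simp add: U_def divide_right_mono)
    qed
    have "U \<longlonglongrightarrow> 2 * ((\<Sum>b\<in>B'. \<Sum>c\<in>B'. if b = c then C\<^sup>2 else 0) / (real n)\<^sup>2)
        + 2 * (\<Sum>b\<in>B'. 0)\<^sup>2"
      unfolding U_def \<eta>_def
    proof (intro tendsto_intros)
      show "(\<lambda>N. if b = c then C\<^sup>2 else D b c N) \<longlonglongrightarrow> (if b = c then C\<^sup>2 else 0)"
        if "b \<in> B'" "c \<in> B'" for b c
        using corr[of b c] that B' by (auto simp: D_def[abs_def])
    qed (use n0 e B' in auto)
    also have "2 * ((\<Sum>b\<in>B'. \<Sum>c\<in>B'. if b = c then C\<^sup>2 else 0) / (real n)\<^sup>2) + 2 * (\<Sum>b\<in>B'. 0)\<^sup>2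
        = 2 * C\<^sup>2 / real n"
      using n0 B' by (simp add: sum.delta power2_eq_square)
    finally have "U \<longlonglongrightarrow> 2 * C\<^sup>2 / real n" .
    moreover have "2 * C\<^sup>2 / real n < \<epsilon>"
      using n n0 \<epsilon> by (simp add: field_simps)
    ultimately have "\<forall>\<^sub>F N in sequentially. U N < \<epsilon>"
      by (rule order_tendstoD)
    then show ?thesis
      by eventually_elim (use upper in \<open>auto intro: le_less_trans\<close>)
  qed
  then show ?thesis
    unfolding null_average_def
    by (intro order_tendstoI) (auto intro!: always_eventually less_le_trans[OF _ m_square_nonneg] ba)
qed

end

section \<open>Differences of translated and dilated polynomials\<close>

lemma coeff_pcompose_translate:
  fixes r :: "'a::field poly"
  shows "coeff (pcompose r [:b, 1:]) i = (\<Sum>k\<le>degree r. coeff r k * coeff ([:b, 1:] ^ k) i)"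
proof -
  have "pcompose r [:b, 1:] = pcompose (\<Sum>k\<le>degree r. monom (coeff r k) k) [:b, 1:]"
    by (simp add: poly_as_sum_of_monoms)
  also have "\<dots> = (\<Sum>k\<le>degree r. smult (coeff r k) ([:b, 1:] ^ k))"
    unfolding pcompose_sum
  proof (intro sum.cong refl)
    fix k
    have "pcompose ([:0, 1:] ^ k) [:b, 1:] = [:b, 1:] ^ k"
      by (induction k) (simp_all add: pcompose_mult pcompose_1 pcompose_pCons)
    then show "pcompose (monom (coeff r k) k) [:b, 1:] = smult (coeff r k) ([:b, 1:] ^ k)"
      by (simp add: monom_altdef pcompose_smult)
  qed
  finally show ?thesis
    by (simp add: coeff_sum)
qed

text \<open>
  Below the cancelling top coefficient, with $n$ the degree and $r_n$ the leading coefficient of $r$,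
  the next coefficient is $n r_n (b - c)$. It is nonzero because the characteristic does not divide $n$.
\<close>
lemma degree_translate_diff:
  fixes r :: "'a::field poly"
  assumes "b \<noteq> c" "degree r > 0" "CHAR('a) = 0 \<or> degree r < CHAR('a)"
  shows "degree (pcompose r [:b, 1:] - pcompose r [:c, 1:]) = degree r - 1"
proof -
  define q where "q = pcompose r [:b, 1:] - pcompose r [:c, 1:]"
  obtain k where k: "degree r = Suc k"
    using assms(2) by (cases "degree r") auto
  have second: "coeff (pcompose r [:x, 1:]) k = coeff r k + of_nat (Suc k) * x * lead_coeff r" for x
  proof -
    have "(\<Sum>i<k. coeff r i * coeff ([:x, 1:] ^ i) k) = 0"
      by (intro sum.neutral) (auto simp: coeff_eq_0 degree_linear_power)
    then show ?thesis
      unfolding coeff_pcompose_translate k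
      by (simp add: lessThan_Suc_atMost[symmetric] coeff_linear_poly_power of_nat_1[unfolded One_nat_def] del: of_nat_Suc power_Suc binomial_Suc_Suc)
  qed
  have top: "coeff (pcompose r [:x, 1:]) (degree r) = lead_coeff r" for x
    using lead_coeff_comp[of "[:x, 1:]" r] by (simp add: degree_pcompose)
  have "degree q \<le> degree r"
    unfolding q_def by (intro degree_diff_le) (simp_all add: degree_pcompose)
  moreover have "coeff q (degree r) = 0"
    unfolding q_def using top by simp
  ultimately have "degree q < degree r"
    using assms(2) by (metis degree_0 leading_coeff_0_iff le_neq_implies_less)
  moreover have "of_nat (Suc k) \<noteq> (0 :: 'a)"
    using assms(3) k by (auto simp: of_nat_eq_0_iff_char_dvd dest: dvd_imp_le simp del: of_nat_Suc)
  then have "coeff q k \<noteq> 0"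
    using assms(1,2) unfolding q_def by (auto simp: second simp del: of_nat_Suc)
  then have "k \<le> degree q"
    by (rule le_degree)
  ultimately show ?thesis
    using k by (simp add: q_def)
qed

text \<open>
  This polynomial is the relative shift of the dilated copies of \<open>h\<close> in \<open>linearly_null_affine_null\<close>. Its
  top coefficient is a nonzero multiple of \<open>b ^ Suc (degree p) - c ^ Suc (degree p)\<close>.
\<close>
lemma degree_dilate_diff:
  fixes p :: "'a::field poly"
  assumes "b \<noteq> 0" "c \<noteq> 0" "b ^ Suc (degree p) \<noteq> c ^ Suc (degree p)" "p \<noteq> 0"
  shows "degree (smult (1 / c) (pcompose p [:0, b:]) - smult (1 / b) (pcompose p [:0, c:])) = degree p"
proof -
  define q where "q = smult (1 / c) (pcompose p [:0, b:]) - smult (1 / b) (pcompose p [:0, c:])"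
  have top: "coeff (pcompose p [:0, x:]) (degree p) = lead_coeff p * x ^ degree p" if "x \<noteq> 0" for x
    using lead_coeff_comp[of "[:0, x:]" p] that by (simp add: degree_pcompose)
  have "degree q \<le> degree p"
    unfolding q_def using assms by (intro degree_diff_le) (simp_all add: degree_pcompose)
  moreover have "coeff q (degree p) = lead_coeff p * (b ^ Suc (degree p) - c ^ Suc (degree p)) / (b * c)"
    unfolding q_def using assms(1,2) by (simp add: top field_simps)
  then have "degree p \<le> degree q"
    using assms by (intro le_degree) auto
  ultimately show ?thesis
    by (simp add: q_def)
qed

text \<open>
  Each power is attained by finitely many elements only, as these are the roots of a polynomial.
\<close>
lemma infinite_distinct_powers:
  assumes "infinite (UNIV :: 'a::field set)"
  obtains B :: "'a::field set" where "infinite B" "0 \<notin> B" "inj_on (\<lambda>b. b ^ Suc n) B"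
proof -
  have "infinite ((\<lambda>b. b ^ Suc n) ` (UNIV - {0 :: 'a}))"
  proof
    assume "finite ((\<lambda>b. b ^ Suc n) ` (UNIV - {0 :: 'a}))"
    then obtain b :: 'a where "infinite {a \<in> UNIV - {0}. a ^ Suc n = b ^ Suc n}"
      using pigeonhole_infinite[of "UNIV - {0 :: 'a}" "\<lambda>b. b ^ Suc n"] assms by auto
    moreover have "{a \<in> UNIV - {0}. a ^ Suc n = b ^ Suc n} \<subseteq> {a. poly (monom 1 (Suc n) - [:b ^ Suc n:]) a = 0}"
      by (auto simp: poly_monom)
    moreover have "coeff (monom 1 (Suc n) - [:b ^ Suc n:]) (Suc n) = (1 :: 'a)"
      by simp
    then have "monom 1 (Suc n) - [:b ^ Suc n:] \<noteq> 0"
      by (metis coeff_0 zero_neq_one)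
    ultimately show False
      using poly_roots_finite finite_subset by blast
  qed
  moreover obtain B where "B \<subseteq> UNIV - {0 :: 'a}" "inj_on (\<lambda>b. b ^ Suc n) B"
    "(\<lambda>b. b ^ Suc n) ` (UNIV - {0 :: 'a}) = (\<lambda>b. b ^ Suc n) ` B"
    by (metis subset_image_inj order_refl)
  ultimately show ?thesis
    using that[of B] by auto
qed

section \<open>Polynomial averages of coboundaries\<close>

context affine_mean_folner
begin

lemma null_average_uniform:
  assumes a: "\<And>u. bdd (a u)" and e: "e \<longlonglongrightarrow> 0"
    and le: "\<And>N v. \<bar>avg (F N) (\<lambda>u. a u v)\<bar> \<le> e N"
  shows "null_average a"
  unfolding null_average_def
proof (rule tendsto_sandwich)
  show "\<forall>\<^sub>F N in sequentially. 0 \<le> m (\<lambda>v. (avg (F N) (\<lambda>u. a u v))\<^sup>2)"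
    using a by (intro always_eventually allI m_square_nonneg)
  have "m (\<lambda>v. (avg (F N) (\<lambda>u. a u v))\<^sup>2) \<le> (e N)\<^sup>2" for N
  proof -
    have "\<bar>(avg (F N) (\<lambda>u. a u v))\<^sup>2\<bar> \<le> (e N)\<^sup>2" for v
      using power_mono[OF le[of N v] abs_ge_zero, of 2] by simp
    then show ?thesis
      by (rule order_trans[OF abs_ge_self m_abs_le])
  qed
  then show "\<forall>\<^sub>F N in sequentially. m (\<lambda>v. (avg (F N) (\<lambda>u. a u v))\<^sup>2) \<le> (e N)\<^sup>2"
    by simp
  show "(\<lambda>N. (e N)\<^sup>2) \<longlonglongrightarrow> 0"
    using tendsto_power[OF e, of 2] by simp
qed auto

lemma null_average_weak:
  assumes a: "\<And>u. bdd (a u)" "null_average a" and k: "bdd k"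
  shows "(\<lambda>N. avg (F N) (\<lambda>u. m (\<lambda>v. a u v * k v))) \<longlonglongrightarrow> 0"
proof -
  obtain K where K: "\<And>v. \<bar>k v\<bar> \<le> K"
    using k by (rule bddE) blast
  have bound: "\<bar>avg (F N) (\<lambda>u. m (\<lambda>v. a u v * k v))\<bar>
      \<le> sqrt (K\<^sup>2 * m (\<lambda>v. (avg (F N) (\<lambda>u. a u v))\<^sup>2))" for N
  proof -
    have "avg (F N) (\<lambda>u. m (\<lambda>v. a u v * k v)) = m (\<lambda>v. avg (F N) (\<lambda>u. a u v * k v))"
      using a k by (intro m_avg[symmetric] bdd_intros)
    also have "\<dots> = m (\<lambda>v. avg (F N) (\<lambda>u. a u v) * k v)"
      by (simp add: avg_def sum_distrib_right)
    finally show ?thesis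
      using real_sqrt_le_mono[OF m_mult_squared_le[OF bdd_avg[OF a(1)] K, of "F N" "\<lambda>u. u"]]
      by simp
  qed
  have "(\<lambda>N. sqrt (K\<^sup>2 * m (\<lambda>v. (avg (F N) (\<lambda>u. a u v))\<^sup>2))) \<longlonglongrightarrow> sqrt (K\<^sup>2 * 0)"
    using a(2) unfolding null_average_def by (intro tendsto_intros)
  then have "(\<lambda>N. sqrt (K\<^sup>2 * m (\<lambda>v. (avg (F N) (\<lambda>u. a u v))\<^sup>2))) \<longlonglongrightarrow> 0"
    by simp
  then show ?thesis
    by (rule tendsto_0_dominated) (rule bound)
qed

lemma null_average_midpoint:
  assumes "\<And>u. bdd (a u)" "\<And>u. bdd (b u)" "null_average a" "null_average b"
  shows "null_average (\<lambda>u v. (a u v + b u v) / 2)"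
  unfolding null_average_def
proof (rule tendsto_sandwich)
  let ?X = "\<lambda>a N. m (\<lambda>v. (avg (F N) (\<lambda>u. a u v))\<^sup>2)"
  show "\<forall>\<^sub>F N in sequentially. 0 \<le> ?X (\<lambda>u v. (a u v + b u v) / 2) N"
    using assms by (intro always_eventually allI m_square_nonneg bdd_intros)
  have "?X (\<lambda>u v. (a u v + b u v) / 2) N \<le> ?X a N + ?X b N" for N
  proof -
    have "?X (\<lambda>u v. (a u v + b u v) / 2) N \<le>
        m (\<lambda>v. (avg (F N) (\<lambda>u. a u v))\<^sup>2 + (avg (F N) (\<lambda>u. b u v))\<^sup>2)"
    proof (rule m_mono)
      fix v
      let ?s = "avg (F N) (\<lambda>u. a u v)" and ?t = "avg (F N) (\<lambda>u. b u v)"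
      have "avg (F N) (\<lambda>u. (a u v + b u v) / 2) = (?s + ?t) / 2"
        using avg_scale[of "F N" "1 / 2" "\<lambda>u. a u v + b u v"] by (simp add: avg_add)
      then have "(avg (F N) (\<lambda>u. (a u v + b u v) / 2))\<^sup>2 = ((?s + ?t) / 2)\<^sup>2"
        by (rule arg_cong)
      also have "((?s + ?t) / 2)\<^sup>2 \<le> ?s\<^sup>2 + ?t\<^sup>2"
      proof -
        have "((s + t) / 2)\<^sup>2 \<le> s\<^sup>2 + t\<^sup>2" for s t :: real
        proof -
          have "((s + t) / 2)\<^sup>2 = (s\<^sup>2 + t\<^sup>2 + 2 * s * t) / 4"
            by (simp add: power2_sum power_divide)
          also have "\<dots> \<le> (s\<^sup>2 + t\<^sup>2 + (s\<^sup>2 + t\<^sup>2)) / 4"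
            by (intro divide_right_mono add_left_mono sum_squares_bound) simp
          also have "\<dots> \<le> s\<^sup>2 + t\<^sup>2"
            by simp
          finally show ?thesis .
        qed
        then show ?thesis .
      qed
      finally show "(avg (F N) (\<lambda>u. (a u v + b u v) / 2))\<^sup>2 \<le> ?s\<^sup>2 + ?t\<^sup>2" .
    qed (use assms in \<open>auto intro!: bdd_intros\<close>)
    also have "\<dots> = ?X a N + ?X b N"
      using assms by (intro m_add bdd_intros)
    finally show ?thesis .
  qed
  then show "\<forall>\<^sub>F N in sequentially. ?X (\<lambda>u v. (a u v + b u v) / 2) N \<le> ?X a N + ?X b N"
    by simp
  show "(\<lambda>N. ?X a N + ?X b N) \<longlonglongrightarrow> 0"
    using tendsto_add[OF assms(3,4)[unfolded null_average_def]] by simp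
qed auto

lemma null_average_affine:
  assumes "\<And>u. bdd (a u)" "null_average a" "c \<noteq> 0"
  shows "null_average (\<lambda>u v. a u (c * v + t))"
proof -
  have "m (\<lambda>v. (avg (F N) (\<lambda>u. a u (c * v + t)))\<^sup>2) = m (\<lambda>v. (avg (F N) (\<lambda>u. a u v))\<^sup>2)" for N
    using assms by (intro m_affine[where f = "\<lambda>v. (avg (F N) (\<lambda>u. a u v))\<^sup>2"] bdd_intros)
  then show ?thesis
    using assms(2) by (simp add: null_average_def)
qed

text \<open>
  The functions that vanish on average along every non-constant linear polynomial. They play the part
  of the orthogonal complement of the translation invariant functions.
\<close>
definition linearly_null :: "('a \<Rightarrow> real) \<Rightarrow> bool" where
  "linearly_null h \<longleftrightarrow> bdd h \<and> (\<forall>c. c \<noteq> 0 \<longrightarrow> null_average (\<lambda>u v. h (v + c * u)))"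

text \<open>
  Along $u \mapsto v + cu$, the shift by $s$ is the translation of $u$ by $s/c$, under which averages
  over $F_N$ are asymptotically invariant.
\<close>
lemma linearly_null_coboundary:
  assumes f: "bdd f" shows "linearly_null (\<lambda>v. f v - f (v + s))"
  unfolding linearly_null_def
proof (intro conjI allI impI)
  show "bdd (\<lambda>v. f v - f (v + s))"
    using f by (intro bdd_intros bdd_comp[OF f])
  fix c :: 'a assume c: "c \<noteq> 0"
  obtain C where C: "\<And>v. \<bar>f v\<bar> \<le> C"
    using f by (rule bddE) blast
  obtain e where e: "e \<longlonglongrightarrow> 0"
    "\<And>N x. (\<And>u. \<bar>x u\<bar> \<le> C) \<Longrightarrow> \<bar>avg (F N) (\<lambda>u. x (u + s / c)) - avg (F N) x\<bar> \<le> e N"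
    by (rule avg_reparam_uniform[OF asymp_invariant_translation[OF folner, of "s / c"] F_finite F_nonempty, of C]) blast
  show "null_average (\<lambda>u v. f (v + c * u) - f (v + c * u + s))"
  proof (rule null_average_uniform[OF _ e(1)])
    show "bdd (\<lambda>v. f (v + c * u) - f (v + c * u + s))" for u
      by (intro bdd_intros bdd_comp[OF f])
    show "\<bar>avg (F N) (\<lambda>u. f (v + c * u) - f (v + c * u + s))\<bar> \<le> e N" for N v
      using e(2)[of "\<lambda>u. f (v + c * u)" N] C c
      by (simp add: avg_diff abs_minus_commute distrib_left add.assoc)
  qed
qed

lemma linearly_null_midpoint:
  assumes "linearly_null h" "linearly_null k" shows "linearly_null (\<lambda>v. (h v + k v) / 2)"
proof -
  have b: "bdd h" "bdd k"
    using assms by (simp_all add: linearly_null_def)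
  have "null_average (\<lambda>u v. (h (v + c * u) + k (v + c * u)) / 2)" if "c \<noteq> 0" for c
    using assms that
    by (intro null_average_midpoint bdd_comp[OF b(1)] bdd_comp[OF b(2)]) (auto simp: linearly_null_def)
  then show ?thesis
    using b by (simp add: linearly_null_def bdd_intros)
qed

lemma linearly_null_dilate:
  assumes h: "linearly_null h" and b: "b \<noteq> 0" shows "linearly_null (\<lambda>v. h (b * v))"
  unfolding linearly_null_def
proof (intro conjI allI impI)
  have bh: "bdd h" using h by (simp add: linearly_null_def)
  show "bdd (\<lambda>v. h (b * v))"
    by (rule bdd_comp[OF bh])
  fix c :: 'a assume "c \<noteq> 0"
  then have "null_average (\<lambda>u v. h (v + (b * c) * u))"
    using h b by (simp add: linearly_null_def)
  from null_average_affine[OF bdd_comp[OF bh] this b, of 0]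
  show "null_average (\<lambda>u v. h (b * (v + c * u)))"
    by (simp add: distrib_left mult.assoc)
qed

text \<open>
  Induction on the degree. In the van der Corput inequality for translations of \<open>u\<close>, translating \<open>v\<close>
  turns the correlation of the shifts by \<open>r (u + b)\<close> and \<open>r (u + c)\<close> into the correlation of \<open>h\<close> with
  its shift by \<open>r (u + b) - r (u + c)\<close>, a polynomial in \<open>u\<close> of degree one less.
\<close>
lemma linearly_null_polynomially_null:
  assumes h: "linearly_null h"
    and r: "degree r > 0" "CHAR('a) = 0 \<or> degree r < CHAR('a)"
  shows "null_average (\<lambda>u v. h (v + poly r u))"
  using r
proof (induction "degree r" arbitrary: r rule: less_induct)
  case less
  have bh: "bdd h" using h by (simp add: linearly_null_def)
  show ?case
  proof (cases "degree r = 1")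
    case True
    then obtain e c where r: "r = [:e, c:]" "c \<noteq> 0"
      by (metis degree1_coeffs)
    then have "null_average (\<lambda>u v. h (v + c * u))"
      using h by (simp add: linearly_null_def)
    from null_average_affine[OF bdd_comp[OF bh] this, of 1 e] show ?thesis
      by (simp add: r add_ac mult.commute)
  next
    case False
    obtain C where C: "\<And>v. \<bar>h v\<bar> \<le> C"
      using bh by (rule bddE) blast
    show ?thesis
    proof (rule van_der_Corput[where \<tau> = "\<lambda>b u. u + b"])
      show "\<bar>h (v + poly r u)\<bar> \<le> C" for u v
        by (rule C)
      show "infinite (UNIV :: 'a set)"
        by (rule infinite_field)
      show "asymp_invariant F (\<lambda>u. u + b)" for b
        by (rule asymp_invariant_translation[OF folner])
      fix b c :: 'a assume "b \<noteq> c"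
      define q where "q = pcompose r [:b, 1:] - pcompose r [:c, 1:]"
      have dq: "degree q = degree r - 1"
        unfolding q_def using \<open>b \<noteq> c\<close> less.prems by (rule degree_translate_diff)
      have "null_average (\<lambda>u v. h (v + poly q u))"
        using less.prems False dq by (intro less.hyps) auto
      then have "(\<lambda>N. avg (F N) (\<lambda>u. m (\<lambda>v. h (v + poly q u) * h v))) \<longlonglongrightarrow> 0"
        by (intro null_average_weak bh bdd_comp[OF bh])
      moreover have "m (\<lambda>v. h (v + poly r (u + b)) * h (v + poly r (u + c)))
          = m (\<lambda>v. h (v + poly q u) * h v)" for u
      proof -
        have "m (\<lambda>v. h (v + poly q u) * h v)
            = m (\<lambda>v. h ((v + poly r (u + c)) + poly q u) * h (v + poly r (u + c)))"
          by (intro m_translate[symmetric, where f = "\<lambda>v. h (v + poly q u) * h v"]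
              bdd_intros bh bdd_comp[OF bh])
        then show ?thesis
          by (simp add: q_def poly_pcompose algebra_simps)
      qed
      ultimately show "(\<lambda>N. avg (F N) (\<lambda>u. m (\<lambda>v. h (v + poly r (u + b)) * h (v + poly r (u + c))))) \<longlonglongrightarrow> 0"
        by simp
    qed
  qed
qed

text \<open>
  The same inequality with dilations of \<open>u\<close>. In the correlation of the members with indices \<open>b * u\<close> and
  \<open>c * u\<close>, the substitution \<open>v \<mapsto> b * c * u * v\<close> removes the division by \<open>u\<close>; up to a translation it
  remains to average $h(c(v + q(u)))\, h(bv)$ for a polynomial \<open>q\<close> of the same degree as \<open>p\<close>. Keeping
  this degree is essential: it must stay below the characteristic. The choice of \<open>b\<close> and \<open>c\<close> with
  different powers of exponent \<open>degree p + 1\<close> prevents the leading coefficient from cancelling.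
\<close>
lemma linearly_null_affine_null:
  assumes h: "linearly_null h" and p: "degree p > 0" "CHAR('a) = 0 \<or> degree p < CHAR('a)"
  shows "null_average (\<lambda>u v. h (v / u + poly p u))"
proof -
  have bh: "bdd h" using h by (simp add: linearly_null_def)
  obtain C where C: "\<And>v. \<bar>h v\<bar> \<le> C" "C \<ge> 0"
    using bh by (rule bddE) blast
  obtain B :: "'a set" where B: "infinite B" "0 \<notin> B" "inj_on (\<lambda>b. b ^ Suc (degree p)) B"
    using infinite_distinct_powers[OF infinite_field] .
  show ?thesis
  proof (rule van_der_Corput[where \<tau> = "\<lambda>b u. b * u", OF _ B(1)])
    show "\<bar>h (v / u + poly p u)\<bar> \<le> C" for u v
      by (rule C)
    show "asymp_invariant F (\<lambda>u. b * u)" if "b \<in> B" for b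
      using that B by (intro asymp_invariant_dilation folner) auto
    fix b c assume bc: "b \<in> B" "c \<in> B" "b \<noteq> c"
    then have nz: "b \<noteq> 0" "c \<noteq> 0" and ne: "b ^ Suc (degree p) \<noteq> c ^ Suc (degree p)"
      using B by (blast, blast, meson inj_onD)
    define q where "q = smult (1 / c) (pcompose p [:0, b:]) - smult (1 / b) (pcompose p [:0, c:])"
    have dq: "degree q = degree p"
      unfolding q_def using nz ne p by (intro degree_dilate_diff) auto
    have hc: "linearly_null (\<lambda>v. h (c * v))"
      using h nz(2) by (rule linearly_null_dilate)
    have "null_average (\<lambda>u v. h (c * (v + poly q u)))"
      using linearly_null_polynomially_null[OF hc] p dq by simp
    then have "(\<lambda>N. avg (F N) (\<lambda>u. m (\<lambda>v. h (c * (v + poly q u)) * h (b * v)))) \<longlonglongrightarrow> 0"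
      by (intro null_average_weak bdd_comp[OF bh])
    moreover have "\<bar>h x * h y\<bar> \<le> C * C" for x y
      using C by (simp add: abs_mult mult_mono)
    moreover have "m (\<lambda>v. h (v / (b * u) + poly p (b * u)) * h (v / (c * u) + poly p (c * u)))
        = m (\<lambda>v. h (c * (v + poly q u)) * h (b * v))" if u: "u \<noteq> 0" for u
    proof -
      have "m (\<lambda>v. h (v / (b * u) + poly p (b * u)) * h (v / (c * u) + poly p (c * u)))
          = m (\<lambda>v. h ((b * c * u) * v / (b * u) + poly p (b * u))
                * h ((b * c * u) * v / (c * u) + poly p (c * u)))"
        using nz u by (intro m_dilate[symmetric,
          where f = "\<lambda>v. h (v / (b * u) + poly p (b * u)) * h (v / (c * u) + poly p (c * u))"]
          bdd_intros bdd_comp[OF bh]) auto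
      also have "\<dots> = m (\<lambda>v. h (c * v + poly p (b * u)) * h (b * v + poly p (c * u)))"
        using nz u by (simp add: field_simps)
      also have "\<dots> = m (\<lambda>v. h (c * (v - poly p (c * u) / b) + poly p (b * u))
          * h (b * (v - poly p (c * u) / b) + poly p (c * u)))"
        using m_translate[where f = "\<lambda>v. h (c * v + poly p (b * u)) * h (b * v + poly p (c * u))"
            and b = "- poly p (c * u) / b"]
        by (simp add: bdd_intros bdd_comp[OF bh])
      also have "\<dots> = m (\<lambda>v. h (c * (v + poly q u)) * h (b * v))"
      proof -
        have "c * (v - poly p (c * u) / b) + poly p (b * u) = c * (v + poly q u)"
          "b * (v - poly p (c * u) / b) + poly p (c * u) = b * v" for v
          using nz by (simp_all add: q_def poly_pcompose field_simps)
        then show ?thesis by simp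
      qed
      finally show ?thesis .
    qed
    ultimately show "(\<lambda>N. avg (F N) (\<lambda>u. m (\<lambda>v. h (v / (b * u) + poly p (b * u))
        * h (v / (c * u) + poly p (c * u))))) \<longlonglongrightarrow> 0"
      by (rule_tac avg_off_zero[where C = "C * C", rotated 3]) (simp_all add: m_abs_le)
  qed
qed

end

section \<open>Nearly invariant functions\<close>

text \<open>
  Midpoints are the only convex combinations needed for the parallelogram identity, and each property
  of the hull reduces to one induction.
\<close>
inductive_set midpoint_hull :: "('a \<Rightarrow> 'a) set \<Rightarrow> ('a \<Rightarrow> real) \<Rightarrow> ('a \<Rightarrow> real) set"
  for G f where
  orbit: "\<sigma> \<in> G \<Longrightarrow> (\<lambda>v. f (\<sigma> v)) \<in> midpoint_hull G f"
| midpoint: "g \<in> midpoint_hull G f \<Longrightarrow> h \<in> midpoint_hull G f \<Longrightarrow>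
    (\<lambda>v. (g v + h v) / 2) \<in> midpoint_hull G f"

lemma midpoint_hull_comp:
  assumes "g \<in> midpoint_hull G f" "\<sigma> \<in> G" "\<And>\<tau>. \<tau> \<in> G \<Longrightarrow> (\<lambda>v. \<tau> (\<sigma> v)) \<in> G"
  shows "(\<lambda>v. g (\<sigma> v)) \<in> midpoint_hull G f"
  using assms(1)
proof induction
  case (orbit \<tau>)
  then show ?case
    using midpoint_hull.orbit[of "\<lambda>v. \<tau> (\<sigma> v)" G f] assms(3) by simp
next
  case (midpoint g h)
  then show ?case
    using midpoint_hull.midpoint[of "\<lambda>v. g (\<sigma> v)" G f "\<lambda>v. h (\<sigma> v)"] by simp
qed

lemma midpoint_hull_bounds:
  assumes "g \<in> midpoint_hull G f" "\<And>v. a \<le> f v \<and> f v \<le> b"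
  shows "a \<le> g v \<and> g v \<le> b"
  using assms(1)
proof (induction arbitrary: v)
  case (midpoint g h)
  from midpoint.IH(1)[of v] midpoint.IH(2)[of v] show ?case by auto
qed (use assms(2) in auto)

lemma midpoint_hull_bdd: "g \<in> midpoint_hull G f \<Longrightarrow> bdd f \<Longrightarrow> bdd g"
  by (induction rule: midpoint_hull.induct) (auto intro!: bdd_intros intro: bdd_comp)

context affine_mean
begin

lemma midpoint_hull_mean:
  assumes "g \<in> midpoint_hull G f" "bdd f" "\<And>\<sigma>. \<sigma> \<in> G \<Longrightarrow> m (\<lambda>v. f (\<sigma> v)) = m f"
  shows "m g = m f"
  using assms(1)
proof induction
  case (midpoint g h)
  then have "bdd g" "bdd h"
    using assms(2) by (auto intro: midpoint_hull_bdd)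
  then have "m (\<lambda>v. (1 / 2) * (g v + h v)) = (1 / 2) * (m g + m h)"
    by (simp only: m_scale m_add bdd_intros)
  then show ?case
    using midpoint.IH by simp
qed (use assms(3) in simp)

text \<open>
  Used for \<open>x\<close> nearly invariant: then every coboundary of \<open>f\<close> is nearly orthogonal to \<open>x\<close>, and the bound
  passes to \<open>f - g\<close> without any loss from the number of midpoints formed.
\<close>
lemma midpoint_hull_pairing:
  assumes "g \<in> midpoint_hull G f" "bdd f" "bdd x"
    and K: "\<And>\<sigma>. \<sigma> \<in> G \<Longrightarrow> \<bar>m (\<lambda>v. x v * (f v - f (\<sigma> v)))\<bar> \<le> K"
  shows "\<bar>m (\<lambda>v. x v * (f v - g v))\<bar> \<le> K"
  using assms(1)
proof induction
  case (midpoint g h)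
  then have "bdd g" "bdd h"
    using assms(2) by (auto intro: midpoint_hull_bdd)
  then have "m (\<lambda>v. (1 / 2) * (x v * (f v - g v) + x v * (f v - h v)))
      = (1 / 2) * (m (\<lambda>v. x v * (f v - g v)) + m (\<lambda>v. x v * (f v - h v)))"
    using assms(2,3) by (simp only: m_scale m_add bdd_intros)
  moreover have "(\<lambda>v. (1 / 2) * (x v * (f v - g v) + x v * (f v - h v)))
      = (\<lambda>v. x v * (f v - (g v + h v) / 2))"
    by (auto simp: field_simps)
  ultimately show ?case
    using midpoint.IH by (simp add: abs_le_iff)
qed (use K in simp)

text \<open>
  The norm of \<open>g\<close> is chosen close to the infimum over the hull. Both \<open>g \<circ> \<sigma>\<close> and its midpoint with \<open>g\<close>
  lie in the hull, so by the parallelogram identity a large difference between \<open>g \<circ> \<sigma>\<close> and \<open>g\<close> would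
  make the midpoint too short. The bound is the same for all \<open>\<sigma>\<close>.
\<close>
lemma nearly_invariant_point:
  assumes G: "G \<noteq> {}" "\<And>\<sigma> \<tau>. \<sigma> \<in> G \<Longrightarrow> \<tau> \<in> G \<Longrightarrow> (\<lambda>v. \<tau> (\<sigma> v)) \<in> G"
    and inv: "\<And>\<sigma> k. \<sigma> \<in> G \<Longrightarrow> bdd k \<Longrightarrow> m (\<lambda>v. k (\<sigma> v)) = m k"
    and f: "bdd f" and \<delta>: "\<delta> > 0"
  obtains g where "g \<in> midpoint_hull G f"
    "\<And>\<sigma>. \<sigma> \<in> G \<Longrightarrow> m (\<lambda>v. (g (\<sigma> v) - g v)\<^sup>2) \<le> \<delta>"
proof -
  let ?H = "midpoint_hull G f"
  define I where "I = (INF g\<in>?H. m (\<lambda>v. (g v)\<^sup>2))"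
  have bH: "bdd g" if "g \<in> ?H" for g
    using that f by (rule midpoint_hull_bdd)
  have ne: "?H \<noteq> {}"
    using G(1) midpoint_hull.orbit by blast
  have below: "bdd_below ((\<lambda>g. m (\<lambda>v. (g v)\<^sup>2)) ` ?H)"
    using bH by (intro bdd_belowI[of _ 0]) (auto intro!: m_nonneg bdd_intros)
  have I_le: "I \<le> m (\<lambda>v. (g v)\<^sup>2)" if "g \<in> ?H" for g
    unfolding I_def using below that by (rule cINF_lower)
  have "\<exists>g\<in>?H. m (\<lambda>v. (g v)\<^sup>2) < I + \<delta> / 4"
    using cINF_less_iff[OF ne below, of "I + \<delta> / 4"] \<delta> by (simp add: I_def)
  then obtain g where g: "g \<in> ?H" "m (\<lambda>v. (g v)\<^sup>2) < I + \<delta> / 4"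
    by blast
  have "m (\<lambda>v. (g (\<sigma> v) - g v)\<^sup>2) \<le> \<delta>" if \<sigma>: "\<sigma> \<in> G" for \<sigma>
  proof -
    define h where "h = (\<lambda>v. g (\<sigma> v))"
    have h: "h \<in> ?H"
      unfolding h_def by (rule midpoint_hull_comp[OF g(1) \<sigma> G(2)[OF \<sigma>]])
    have bg: "bdd g" and bh: "bdd h"
      using g(1) h bH by auto
    have mh: "m (\<lambda>v. (h v)\<^sup>2) = m (\<lambda>v. (g v)\<^sup>2)"
      unfolding h_def using \<sigma> bg by (intro inv[where k = "\<lambda>v. (g v)\<^sup>2"] bdd_intros)
    have "m (\<lambda>v. (h v - g v)\<^sup>2)
        = m (\<lambda>v. (2 * (h v)\<^sup>2 + 2 * (g v)\<^sup>2) - 4 * ((h v + g v) / 2)\<^sup>2)"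
    proof -
      have "(a - b)\<^sup>2 = (2 * a\<^sup>2 + 2 * b\<^sup>2) - 4 * ((a + b) / 2)\<^sup>2" for a b :: real
        by (simp add: power2_eq_square field_simps)
      then show ?thesis by simp
    qed
    also have "\<dots> = (2 * m (\<lambda>v. (h v)\<^sup>2) + 2 * m (\<lambda>v. (g v)\<^sup>2)) - 4 * m (\<lambda>v. ((h v + g v) / 2)\<^sup>2)"
      by (simp only: m_diff m_add m_scale bdd_intros bg bh)
    also have "\<dots> \<le> \<delta>"
      using I_le[OF midpoint_hull.midpoint[OF h g(1)]] g(2) unfolding mh by linarith
    finally show ?thesis
      by (simp add: h_def)
  qed
  with g(1) show ?thesis
    by (rule that)
qed

end

section \<open>The average of the correlations\<close>

context affine_mean_folner
begin

lemma avg_indicator_zero: "(\<lambda>N. avg (F N) (\<lambda>u. if u = 0 then c else 0)) \<longlonglongrightarrow> 0"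
  by (rule avg_off_zero[where y = "\<lambda>u. 0" and C = "\<bar>c\<bar>"]) (auto simp: avg_def)

text \<open>
  The functions \<open>g\<close> and \<open>k\<close> are the approximate projections of \<open>f\<close>. For \<open>u \<noteq> 0\<close> the correlation is
  \<open>(m f)\<^sup>2\<close> up to four errors of size \<open>\<eta>\<close>, each from approximate invariance, and two terms \<open>\<alpha> u\<close> and
  \<open>\<beta> k u\<close>, which come from \<open>f - g\<close> and \<open>g - k\<close> and are not small individually but vanish on average.
\<close>
lemma average_lower_bound:
  assumes f: "\<And>v. 0 \<le> f v \<and> f v \<le> 1"
    and p: "degree p > 0" "CHAR('a) = 0 \<or> degree p < CHAR('a)" and \<epsilon>: "\<epsilon> > 0"
  shows "\<forall>\<^sub>F N in sequentially.
    (m f)\<^sup>2 - \<epsilon> \<le> avg (F N) (\<lambda>u. m (\<lambda>v. f (v / u + poly p u) * f v))"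
proof -
  define \<eta> where "\<eta> = \<epsilon> / 8"
  have \<eta>: "\<eta> > 0" "\<eta>\<^sup>2 > 0" "0 \<le> \<eta>"
    using \<epsilon> by (auto simp: \<eta>_def)
  define Tr :: "('a \<Rightarrow> 'a) set" where "Tr = range (\<lambda>s v. v + s)"
  define Di :: "('a \<Rightarrow> 'a) set" where "Di = (\<lambda>c v. c * v) ` (UNIV - {0})"
  have bf: "bdd f"
    using f by (intro bddI[of f 1]) (auto simp: abs_le_iff intro: order_trans[of _ 0])
  obtain g where g: "g \<in> midpoint_hull Tr f"
    and gT: "\<And>\<sigma>. \<sigma> \<in> Tr \<Longrightarrow> m (\<lambda>v. (g (\<sigma> v) - g v)\<^sup>2) \<le> \<eta>\<^sup>2"
  proof (rule nearly_invariant_point[OF _ _ _ bf \<eta>(2)])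
    show "Tr \<noteq> {}" by (simp add: Tr_def)
    show "(\<lambda>v. \<tau> (\<sigma> v)) \<in> Tr" if "\<sigma> \<in> Tr" "\<tau> \<in> Tr" for \<sigma> \<tau>
      using that by (auto simp: Tr_def add.assoc)
    show "m (\<lambda>v. k (\<sigma> v)) = m k" if "\<sigma> \<in> Tr" "bdd k" for \<sigma> k
      using that by (auto simp: Tr_def m_translate)
  qed blast
  have bg: "bdd g"
    using g bf by (rule midpoint_hull_bdd)
  have g01: "0 \<le> g v \<and> g v \<le> 1" for v
    using g f by (rule midpoint_hull_bounds)
  obtain k where k: "k \<in> midpoint_hull Di g"
    and kD: "\<And>\<sigma>. \<sigma> \<in> Di \<Longrightarrow> m (\<lambda>v. (k (\<sigma> v) - k v)\<^sup>2) \<le> \<eta>\<^sup>2"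
  proof (rule nearly_invariant_point[OF _ _ _ bg \<eta>(2)])
    show "Di \<noteq> {}"
      unfolding Di_def by (metis DiffI UNIV_I empty_iff image_is_empty singletonD zero_neq_one)
    show "(\<lambda>v. \<tau> (\<sigma> v)) \<in> Di" if \<sigma>\<tau>: "\<sigma> \<in> Di" "\<tau> \<in> Di" for \<sigma> \<tau>
    proof -
      obtain b c where "b \<noteq> 0" "c \<noteq> 0" "\<sigma> = (\<lambda>v. b * v)" "\<tau> = (\<lambda>v. c * v)"
        using \<sigma>\<tau> by (auto simp: Di_def)
      then show ?thesis
        by (auto simp: Di_def mult.assoc intro!: image_eqI[of _ _ "c * b"])
    qed
    show "m (\<lambda>v. x (\<sigma> v)) = m x" if "\<sigma> \<in> Di" "bdd x" for \<sigma> x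
      using that by (auto simp: Di_def intro: m_dilate)
  qed blast
  have bk: "bdd k"
    using k bg by (rule midpoint_hull_bdd)
  have k01: "0 \<le> k v \<and> k v \<le> 1" for v
    using k g01 by (rule midpoint_hull_bounds)
  have le1: "\<bar>f v\<bar> \<le> 1" "\<bar>g v\<bar> \<le> 1" "\<bar>k v\<bar> \<le> 1" for v
    using f[of v] g01[of v] k01[of v] by auto
  note bs = bdd_intros bdd_comp[OF bf] bdd_comp[OF bg] bdd_comp[OF bk] bf bg bk
  have transl: "m (\<lambda>v. (g (v + s) - g v)\<^sup>2) \<le> \<eta>\<^sup>2" for s
    using gT[of "\<lambda>v. v + s"] by (auto simp: Tr_def)
  have dil: "m (\<lambda>v. (k (c * v) - k v)\<^sup>2) \<le> \<eta>\<^sup>2" if "c \<noteq> 0" for c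
    using kD[of "\<lambda>v. c * v"] that by (auto simp: Di_def)
  define \<phi> where "\<phi> u = m (\<lambda>v. f (v / u + poly p u) * f v)" for u
  define \<alpha> where "\<alpha> u = m (\<lambda>v. (f (v / u + poly p u) - g (v / u + poly p u)) * f v)" for u
  define \<beta> where "\<beta> x u = m (\<lambda>v. (g (v / u) - x (v / u)) * g v)" for x u

  \<comment> \<open>\<open>f - g\<close> is a combination of translation coboundaries\<close>
  have "linearly_null (\<lambda>v. f v - g v)"
    using g
  proof induction
    case (orbit \<sigma>)
    then show ?case
      using bf by (auto simp: Tr_def intro: linearly_null_coboundary)
  next
    case (midpoint g h)
    from linearly_null_midpoint[OF midpoint.IH] show ?case
      by (rule back_subst[of linearly_null]) (auto simp: field_simps)
  qed
  from linearly_null_affine_null[OF this p] have lim_\<alpha>: "(\<lambda>N. avg (F N) \<alpha>) \<longlonglongrightarrow> 0"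
    unfolding \<alpha>_def by (intro null_average_weak bs)

  \<comment> \<open>\<open>g - k\<close> is a combination of dilation coboundaries, and dilating \<open>v\<close> in \<open>g (v / u)\<close> by \<open>c\<close> amounts to
      dilating \<open>u\<close> by \<open>1 / c\<close>\<close>
  have lim_\<beta>: "(\<lambda>N. avg (F N) (\<beta> k)) \<longlonglongrightarrow> 0"
    using k
  proof induction
    case (orbit \<sigma>)
    then obtain c where c: "c \<noteq> 0" "\<sigma> = (\<lambda>v. c * v)"
      by (auto simp: Di_def)
    define y where "y u = m (\<lambda>v. g (v / u) * g v)" for u
    have y1: "\<bar>y u\<bar> \<le> 1" for u
      unfolding y_def using le1 by (intro m_abs_le) (simp add: abs_mult mult_le_one)
    obtain e where e: "e \<longlonglongrightarrow> 0"
      "\<And>N x. (\<And>u. \<bar>x u\<bar> \<le> 1) \<Longrightarrow> \<bar>avg (F N) (\<lambda>u. x ((1 / c) * u)) - avg (F N) x\<bar> \<le> e N"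
      by (rule avg_reparam_uniform[OF asymp_invariant_dilation[OF folner, of "1 / c"] F_finite F_nonempty, of 1])
        (use c in auto)
    have eq: "\<beta> (\<lambda>v. g (\<sigma> v)) u = y u - y ((1 / c) * u)" for u
    proof -
      have "\<beta> (\<lambda>v. g (\<sigma> v)) u = m (\<lambda>v. g (v / u) * g v - g (v / ((1 / c) * u)) * g v)"
        by (simp add: \<beta>_def c algebra_simps)
      also have "\<dots> = y u - y ((1 / c) * u)"
        unfolding y_def by (intro m_diff bs)
      finally show ?thesis .
    qed
    have "\<bar>avg (F N) (\<beta> (\<lambda>v. g (\<sigma> v)))\<bar> \<le> e N" for N
      using e(2)[of y N, OF y1] unfolding eq avg_diff by (simp add: abs_minus_commute)
    with e(1) show ?case
      by (rule tendsto_0_dominated)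
  next
    case (midpoint x z)
    have b: "bdd x" "bdd z"
      using midpoint.hyps bg by (auto intro: midpoint_hull_bdd)
    have "\<beta> (\<lambda>v. (x v + z v) / 2) = (\<lambda>u. (1 / 2) * (\<beta> x u + \<beta> z u))"
    proof
      fix u
      have "\<beta> (\<lambda>v. (x v + z v) / 2) u
        = m (\<lambda>v. (1 / 2) * ((g (v / u) - x (v / u)) * g v + (g (v / u) - z (v / u)) * g v))"
        unfolding \<beta>_def by (rule arg_cong[of _ _ m]) (auto simp: field_simps)
      also have "\<dots> = (1 / 2) * (\<beta> x u + \<beta> z u)"
        unfolding \<beta>_def
        by (simp only: m_scale m_add bs bdd_comp[OF b(1)] bdd_comp[OF b(2)])
      finally show "\<beta> (\<lambda>v. (x v + z v) / 2) u = (1 / 2) * (\<beta> x u + \<beta> z u)" .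
    qed
    then have half: "avg (F N) (\<beta> (\<lambda>v. (x v + z v) / 2)) = (1 / 2) * (avg (F N) (\<beta> x) + avg (F N) (\<beta> z))" for N
      by (simp only: avg_scale avg_add)
    show ?case
      unfolding half using tendsto_mult[OF tendsto_const tendsto_add[OF midpoint.IH], of "1 / 2"] by simp
  qed

  have main: "\<alpha> u + \<beta> k u + (m f)\<^sup>2 - 4 * \<eta> \<le> \<phi> u" if u: "u \<noteq> 0" for u
  proof -
    have s1: "\<phi> u = \<alpha> u + m (\<lambda>v. g (v / u + poly p u) * f v)"
    proof -
      have "\<alpha> u = m (\<lambda>v. f (v / u + poly p u) * f v - g (v / u + poly p u) * f v)"
        by (simp add: \<alpha>_def left_diff_distrib)
      also have "\<dots> = \<phi> u - m (\<lambda>v. g (v / u + poly p u) * f v)"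
        unfolding \<phi>_def by (intro m_diff bs)
      finally show ?thesis by simp
    qed
    have s2: "\<bar>m (\<lambda>v. g (v / u + poly p u) * f v) - m (\<lambda>v. g (v / u) * f v)\<bar> \<le> \<eta>"
    proof -
      have "m (\<lambda>v. (g (v / u + poly p u) - g (v / u))\<^sup>2) = m (\<lambda>v. (g (v + poly p u) - g v)\<^sup>2)"
        using m_dilate[of "\<lambda>v. (g (v + poly p u) - g v)\<^sup>2" "1 / u"] u by (simp add: bs)
      then have "\<bar>m (\<lambda>v. (g (v / u + poly p u) - g (v / u)) * f v)\<bar> \<le> \<eta>"
        using transl le1 \<eta> by (intro m_mult_small bs) auto
      also have "m (\<lambda>v. (g (v / u + poly p u) - g (v / u)) * f v)
          = m (\<lambda>v. g (v / u + poly p u) * f v) - m (\<lambda>v. g (v / u) * f v)"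
        unfolding left_diff_distrib by (intro m_diff bs)
      finally show ?thesis .
    qed
    have s3: "\<bar>m (\<lambda>v. g (v / u) * f v) - m (\<lambda>v. g (v / u) * g v)\<bar> \<le> \<eta>"
    proof -
      have "\<bar>m (\<lambda>v. g (v / u) * (f v - f (\<sigma> v)))\<bar> \<le> \<eta>" if \<sigma>: "\<sigma> \<in> Tr" for \<sigma>
      proof -
        obtain s where s: "\<sigma> = (\<lambda>v. v + s)"
          using \<sigma> by (auto simp: Tr_def)
        have "m (\<lambda>v. (g (v / u) - g ((v - s) / u))\<^sup>2) = m (\<lambda>v. (g v - g (v + - s / u))\<^sup>2)"
          using m_dilate[of "\<lambda>v. (g v - g (v + - s / u))\<^sup>2" "1 / u"] u
          by (simp add: bs diff_divide_distrib)
        also have "\<dots> \<le> \<eta>\<^sup>2"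
          using transl[of "- s / u"] by (simp add: power2_commute)
        finally have "\<bar>m (\<lambda>v. (g (v / u) - g ((v - s) / u)) * f v)\<bar> \<le> \<eta>"
          using le1 \<eta> by (intro m_mult_small bs)
        also have "m (\<lambda>v. (g (v / u) - g ((v - s) / u)) * f v)
            = m (\<lambda>v. g (v / u) * f v) - m (\<lambda>v. g ((v - s) / u) * f v)"
          unfolding left_diff_distrib by (intro m_diff bs)
        also have "m (\<lambda>v. g ((v - s) / u) * f v) = m (\<lambda>v. g (v / u) * f (v + s))"
          using m_translate[of "\<lambda>v. g ((v - s) / u) * f v" s] by (simp add: bs)
        also have "m (\<lambda>v. g (v / u) * f v) - m (\<lambda>v. g (v / u) * f (v + s))
            = m (\<lambda>v. g (v / u) * (f v - f (\<sigma> v)))"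
          unfolding right_diff_distrib s by (intro m_diff[symmetric] bs)
        finally show ?thesis .
      qed
      then have "\<bar>m (\<lambda>v. g (v / u) * (f v - g v))\<bar> \<le> \<eta>"
        by (intro midpoint_hull_pairing[OF g] bs)
      also have "m (\<lambda>v. g (v / u) * (f v - g v)) = m (\<lambda>v. g (v / u) * f v) - m (\<lambda>v. g (v / u) * g v)"
        unfolding right_diff_distrib by (intro m_diff bs)
      finally show ?thesis .
    qed
    have s4: "m (\<lambda>v. g (v / u) * g v) = \<beta> k u + m (\<lambda>v. k (v / u) * g v)"
    proof -
      have "\<beta> k u = m (\<lambda>v. g (v / u) * g v - k (v / u) * g v)"
        by (simp add: \<beta>_def left_diff_distrib)
      also have "\<dots> = m (\<lambda>v. g (v / u) * g v) - m (\<lambda>v. k (v / u) * g v)"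
        by (intro m_diff bs)
      finally show ?thesis by simp
    qed
    have s5: "\<bar>m (\<lambda>v. k (c * v) * g v) - m (\<lambda>v. k v * g v)\<bar> \<le> \<eta>" if c: "c \<noteq> 0" for c
    proof -
      have "\<bar>m (\<lambda>v. (k (c * v) - k v) * g v)\<bar> \<le> \<eta>"
        using dil[OF c] le1 \<eta> by (intro m_mult_small bs)
      also have "m (\<lambda>v. (k (c * v) - k v) * g v) = m (\<lambda>v. k (c * v) * g v) - m (\<lambda>v. k v * g v)"
        unfolding left_diff_distrib by (intro m_diff bs)
      finally show ?thesis .
    qed
    have s6: "\<bar>m (\<lambda>v. k v * g v) - m (\<lambda>v. (k v)\<^sup>2)\<bar> \<le> \<eta>"
    proof -
      have "\<bar>m (\<lambda>v. k v * (g v - g (\<sigma> v)))\<bar> \<le> \<eta>" if \<sigma>: "\<sigma> \<in> Di" for \<sigma>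
      proof -
        obtain c where c: "c \<noteq> 0" "\<sigma> = (\<lambda>v. c * v)"
          using \<sigma> by (auto simp: Di_def)
        have "m (\<lambda>v. k v * (g v - g (\<sigma> v))) = m (\<lambda>v. k v * g v) - m (\<lambda>v. k v * g (c * v))"
          unfolding right_diff_distrib c by (intro m_diff bs)
        also have "m (\<lambda>v. k v * g (c * v)) = m (\<lambda>v. k ((1 / c) * v) * g v)"
          using m_dilate[of "\<lambda>v. k ((1 / c) * v) * g v" c] c by (simp add: bs)
        finally show ?thesis
          using s5[of "1 / c"] c by (simp add: abs_minus_commute)
      qed
      then have "\<bar>m (\<lambda>v. k v * (g v - k v))\<bar> \<le> \<eta>"
        by (intro midpoint_hull_pairing[OF k] bs)
      also have "m (\<lambda>v. k v * (g v - k v)) = m (\<lambda>v. k v * g v) - m (\<lambda>v. (k v)\<^sup>2)"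
        unfolding right_diff_distrib power2_eq_square by (intro m_diff bs)
      finally show ?thesis .
    qed
    have "m k = m g"
      using k bg by (rule midpoint_hull_mean) (auto simp: Di_def intro: m_dilate bg)
    also have "m g = m f"
      using g bf by (rule midpoint_hull_mean) (auto simp: Tr_def intro: m_translate bf)
    finally have s7: "(m f)\<^sup>2 \<le> m (\<lambda>v. (k v)\<^sup>2)"
      using m_squared_le[OF bk] by simp
    have s5': "\<bar>m (\<lambda>v. k (v / u) * g v) - m (\<lambda>v. k v * g v)\<bar> \<le> \<eta>"
      using s5[of "1 / u"] u by simp
    show ?thesis
      using s1 s2 s3 s4 s5' s6 s7 by linarith
  qed
  \<comment> \<open>at \<open>u = 0\<close> each of \<open>\<alpha>\<close>, \<open>\<beta> k\<close> and \<open>(m f)\<^sup>2\<close> is at most \<open>1\<close>, whence the correction by \<open>3\<close>\<close>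
  have main0: "\<alpha> u + \<beta> k u + ((m f)\<^sup>2 - 4 * \<eta>) - (if u = 0 then 3 else 0) \<le> \<phi> u" for u
  proof (cases "u = 0")
    case True
    have fg: "\<bar>f x - g x\<bar> \<le> 1" "\<bar>g x - k x\<bar> \<le> 1" for x
      using f[of x] g01[of x] k01[of x] by auto
    have "\<bar>\<alpha> 0\<bar> \<le> 1" "\<bar>\<beta> k 0\<bar> \<le> 1"
      unfolding \<alpha>_def \<beta>_def using le1 fg
      by (intro m_abs_le; simp add: abs_mult mult_le_one)+
    moreover have "(m f)\<^sup>2 \<le> 1"
      using m_abs_le[of f 1] le1 by (simp add: abs_square_le_1)
    moreover have "0 \<le> \<phi> 0"
      unfolding \<phi>_def using f by (intro m_nonneg bs) auto
    ultimately show ?thesis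
      using True \<eta> by simp
  next
    case False
    then show ?thesis
      using main[of u] by simp
  qed
  define L where "L N = avg (F N) \<alpha> + avg (F N) (\<beta> k) + ((m f)\<^sup>2 - 4 * \<eta>)
      - avg (F N) (\<lambda>u. if u = 0 then 3 else 0)" for N
  have "L \<longlonglongrightarrow> 0 + 0 + ((m f)\<^sup>2 - 4 * \<eta>) - 0"
    unfolding L_def by (intro tendsto_intros lim_\<alpha> lim_\<beta> avg_indicator_zero)
  then have "\<forall>\<^sub>F N in sequentially. (m f)\<^sup>2 - \<epsilon> < L N"
    by (rule order_tendstoD) (use \<epsilon> in \<open>simp add: \<eta>_def\<close>)
  then show ?thesis
  proof eventually_elim
    case (elim N)
    have "L N = avg (F N) (\<lambda>u. \<alpha> u + \<beta> k u + ((m f)\<^sup>2 - 4 * \<eta>) - (if u = 0 then 3 else 0))"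
      unfolding L_def avg_diff avg_add by (simp add: avg_const)
    also have "\<dots> \<le> avg (F N) \<phi>"
      by (intro avg_mono main0)
    finally show ?case
      using elim by (simp add: \<phi>_def[abs_def])
  qed
qed

end

section \<open>Upper density as an invariant mean\<close>

lemma compact_product_of_intervals:
  fixes c :: "'i \<Rightarrow> real"
  shows "compact (\<Pi>\<^sub>E i\<in>UNIV. {- c i..c i})"
  using compactin_PiE[of "\<lambda>i. euclidean" UNIV "\<lambda>i. {- c i..c i}"]
  by (simp add: euclidean_product_topology)

text \<open>
  By Tychonoff's theorem the points $(x_i(n))_i$ have a cluster point $l$ along \<open>G\<close>; intersecting \<open>G\<close>
  with the preimages of the neighbourhoods of $l$ makes all coordinates converge at once.
\<close>
lemma common_limit_filter:
  fixes x :: "'i \<Rightarrow> nat \<Rightarrow> real"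
  assumes G: "G \<noteq> bot" and x: "\<And>i n. \<bar>x i n\<bar> \<le> c i"
  obtains H l where "H \<noteq> bot" "H \<le> G" "\<And>i. (x i \<longlongrightarrow> l i) H"
proof -
  let ?\<Lambda> = "\<lambda>n i. x i n"
  have "\<forall>\<^sub>F y in filtermap ?\<Lambda> G. y \<in> (\<Pi>\<^sub>E i\<in>UNIV. {- c i..c i})"
    unfolding eventually_filtermap using x
    by (intro always_eventually) (auto simp: abs_le_iff minus_le_iff)
  moreover have "filtermap ?\<Lambda> G \<noteq> bot"
    using G by (simp add: filtermap_bot_iff)
  ultimately obtain l where l: "inf (nhds l) (filtermap ?\<Lambda> G) \<noteq> bot"
    using compact_product_of_intervals[of c] unfolding compact_filter by blast
  define H where "H = inf (filtercomap ?\<Lambda> (nhds l)) G"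
  have "H \<noteq> bot"
  proof
    assume "H = bot"
    then have "\<forall>\<^sub>F n in inf (filtercomap ?\<Lambda> (nhds l)) G. False"
      by (simp add: H_def)
    then obtain P Q where PQ: "\<forall>\<^sub>F n in filtercomap ?\<Lambda> (nhds l). P n" "eventually Q G" "\<And>n. \<not> (P n \<and> Q n)"
      unfolding eventually_inf by blast
    then obtain R where R: "eventually R (nhds l)" "\<And>n. R (?\<Lambda> n) \<Longrightarrow> P n"
      unfolding eventually_filtercomap by blast
    have "\<forall>\<^sub>F y in filtermap ?\<Lambda> G. \<not> R y"
      unfolding eventually_filtermap using PQ(2) by eventually_elim (use PQ(3) R(2) in blast)
    with R(1) have "\<forall>\<^sub>F y in inf (nhds l) (filtermap ?\<Lambda> G). False"
      unfolding eventually_inf by blast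
    with l show False
      by (simp add: trivial_limit_def)
  qed
  moreover have "H \<le> G"
    by (simp add: H_def)
  moreover have "(x i \<longlongrightarrow> l i) H" for i
  proof -
    have "filterlim ?\<Lambda> (nhds l) H"
      unfolding filterlim_iff_le_filtercomap H_def by simp
    with continuous_on_product_coordinates[of i] show ?thesis
      by (rule continuous_on_tendsto_compose) auto
  qed
  ultimately show ?thesis
    by (rule that)
qed

lemma avg_indicator: "avg (F N) (indicator S) = real (card (S \<inter> F N)) / real (card (F N))"
  if "finite (F N)"
  using that by (simp add: avg_def indicator_def sum.If_cases Int_commute)

text \<open>
  The filter refines a subsequence along which the density of \<open>E\<close> attains its upper limit. All other
  sets then have a limit at most their upper density, and the F\o lner property makes the limits
  invariant.
\<close>
lemma affine_mean_of_density:
  fixes F :: "nat \<Rightarrow> 'a::field set"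
  assumes F: "double_Folner F"
  obtains m where "affine_mean m" "m (indicator E) = upper_density F E"
    "\<And>S. m (indicator S) \<le> upper_density F S"
proof -
  have fin [simp]: "finite (F N)" and ne [simp]: "F N \<noteq> {}" for N
    using F by (auto simp: double_Folner_def)
  define d where "d S N = avg (F N) (indicator S)" for S and N
  have d: "d S N = real (card (S \<inter> F N)) / real (card (F N))" for S N
    unfolding d_def by (rule avg_indicator) simp
  have ud: "ereal (upper_density F S) = limsup (\<lambda>N. ereal (d S N))" for S
    unfolding d by (rule ereal_upper_density) simp
  obtain r where r: "strict_mono r" "(\<lambda>n. ereal (d E (r n))) \<longlonglongrightarrow> limsup (\<lambda>N. ereal (d E N))"
    using limsup_subseq_lim[of "\<lambda>N. ereal (d E N)"] by (auto simp: o_def)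
  define G where "G = filtermap r sequentially"
  have G: "G \<noteq> bot" "G \<le> sequentially"
    unfolding G_def using filterlim_subseq[OF r(1)] by (simp_all add: filtermap_bot_iff filterlim_def)
  \<comment> \<open>the averages of an unbounded function may be unbounded; they are replaced by \<open>0\<close> so that the
      lemma on common limits applies\<close>
  define x where "x f N = (if bdd f then avg (F N) f else 0)" for f and N
  have "\<exists>c. \<forall>N. \<bar>x f N\<bar> \<le> c" for f
  proof (cases "bdd f")
    case True
    then obtain C where "\<And>v. \<bar>f v\<bar> \<le> C"
      by (rule bddE) blast
    then show ?thesis
      using True by (intro exI[of _ C]) (auto simp: x_def intro!: avg_abs_le)
  qed (auto simp: x_def)
  then obtain c where c: "\<And>f N. \<bar>x f N\<bar> \<le> c f"
    by metis
  obtain H m where H: "H \<noteq> bot" "H \<le> G" "\<And>f. (x f \<longlongrightarrow> m f) H"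
    using common_limit_filter[of G x c, OF G(1) c] by blast
  have lim: "((\<lambda>N. avg (F N) f) \<longlongrightarrow> m f) H" if "bdd f" for f
    using H(3)[of f] that by (simp add: x_def[abs_def])
  have seq: "(y \<longlongrightarrow> l) H" if "y \<longlonglongrightarrow> l" for y and l :: real
    using that H(2) G(2) by (meson filterlim_mono order_refl order_trans)
  have bind: "bdd (indicator S :: 'a \<Rightarrow> real)" for S
    by (rule bddI[of _ 1]) (auto simp: indicator_def)
  have inv: "m (\<lambda>v. f (\<tau> v)) = m f" if f: "bdd f" and \<tau>: "asymp_invariant F \<tau>" for f \<tau>
  proof -
    obtain C where C: "\<And>v. \<bar>f v\<bar> \<le> C"
      using f by (rule bddE) blast
    obtain e where e: "e \<longlonglongrightarrow> 0"
      "\<And>N x. (\<And>u. \<bar>x u\<bar> \<le> C) \<Longrightarrow> \<bar>avg (F N) (\<lambda>u. x (\<tau> u)) - avg (F N) x\<bar> \<le> e N"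
      by (rule avg_reparam_uniform[OF \<tau> fin ne, of C]) blast
    have "(\<lambda>N. avg (F N) (\<lambda>v. f (\<tau> v)) - avg (F N) f) \<longlonglongrightarrow> 0"
      using e(1) by (rule tendsto_0_dominated) (rule e(2)[OF C])
    moreover have "((\<lambda>N. avg (F N) (\<lambda>v. f (\<tau> v)) - avg (F N) f) \<longlongrightarrow> m (\<lambda>v. f (\<tau> v)) - m f) H"
      by (rule tendsto_diff[OF lim[OF bdd_comp[OF f]] lim[OF f]])
    ultimately have "m (\<lambda>v. f (\<tau> v)) - m f = 0"
      using tendsto_unique[OF H(1) _ seq] by blast
    then show ?thesis by simp
  qed
  have "affine_mean m"
  proof
    show "m (\<lambda>v. f v + g v) = m f + m g" if "bdd f" "bdd g" for f g
      by (rule tendsto_unique[OF H(1) lim[OF bdd_add[OF that]]])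
        (use tendsto_add[OF lim[OF that(1)] lim[OF that(2)]] in \<open>simp add: avg_add\<close>)
    show "m (\<lambda>v. c * f v) = c * m f" if "bdd f" for f c
      by (rule tendsto_unique[OF H(1) lim[OF bdd_mult[OF bdd_const that]]])
        (use tendsto_mult[OF tendsto_const lim[OF that]] in \<open>simp add: avg_scale\<close>)
    show "0 \<le> m f" if "bdd f" "\<And>v. 0 \<le> f v" for f
      using that by (intro tendsto_lowerbound[OF lim[OF that(1)] always_eventually H(1)])
        (auto simp: avg_def intro!: divide_nonneg_nonneg sum_nonneg)
    show "m (\<lambda>v. 1) = 1"
      by (rule tendsto_unique[OF H(1) lim[OF bdd_const]]) (simp add: avg_const)
    show "m (\<lambda>v. f (a * v + b)) = m f" if f: "bdd f" and a: "a \<noteq> 0" for f a b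
    proof -
      have "m (\<lambda>v. f (v + b)) = m f"
        by (rule inv[OF f asymp_invariant_translation[OF F]])
      moreover have "m (\<lambda>v. f (a * v + b)) = m (\<lambda>v. f (v + b))"
        by (rule inv[OF bdd_comp[OF f] asymp_invariant_dilation[OF F a]])
      ultimately show ?thesis by simp
    qed
  qed
  moreover have "m (indicator E) = upper_density F E"
  proof -
    have "((\<lambda>N. ereal (d E N)) \<longlongrightarrow> ereal (upper_density F E)) G"
      using r(2) unfolding G_def filterlim_filtermap ud .
    then have "(d E \<longlongrightarrow> upper_density F E) G"
      by simp
    then have "(d E \<longlongrightarrow> upper_density F E) H"
      using H(2) by (rule tendsto_mono[rotated])
    then show ?thesis
      using lim[OF bind[of E]] tendsto_unique[OF H(1)] by (auto simp: d_def[abs_def])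
  qed
  moreover have "m (indicator S) \<le> upper_density F S" for S
  proof -
    have "ereal (m (indicator S)) \<le> limsup (\<lambda>N. ereal (d S N))"
    proof (rule dense_ge)
      fix z assume "limsup (\<lambda>N. ereal (d S N)) < z"
      then have "\<forall>\<^sub>F N in H. ereal (d S N) < z"
        using Limsup_lessD filter_leD[OF H(2)] filter_leD[OF G(2)] by blast
      then have "\<forall>\<^sub>F N in H. ereal (d S N) \<le> z"
        by eventually_elim simp
      moreover have "((\<lambda>N. ereal (d S N)) \<longlongrightarrow> ereal (m (indicator S))) H"
        using lim[OF bind[of S]] by (simp add: d_def)
      ultimately show "ereal (m (indicator S)) \<le> z"
        by (intro tendsto_upperbound[OF _ _ H(1)])
    qed
    then show ?thesis
      by (simp flip: ud)
  qed
  ultimately show ?thesis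
    by (rule that)
qed

section \<open>Positive lower density of the good shifts\<close>

theorem theorem1p12:
  fixes p :: "'a::field poly"
    and F :: "nat \<Rightarrow> 'a set"
    and E :: "'a set"
    and \<epsilon> :: real
  assumes "countable (UNIV :: 'a set)" and "infinite (UNIV :: 'a set)"
    and "degree p > 0" and "admissible p"
    and "double_Folner F"
    and "upper_density F E > 0"
    and "\<epsilon> > 0"
  shows "lower_density F
           {u \<in> UNIV - {0}.
              upper_density F (set_shift E (poly p u) \<inter> set_quot E u)
                \<ge> (upper_density F E)\<^sup>2 - \<epsilon>} > 0"
proof -
  define R where "R = {u \<in> UNIV - {0}.
      upper_density F (set_shift E (poly p u) \<inter> set_quot E u) \<ge> (upper_density F E)\<^sup>2 - \<epsilon>}"
  obtain m where m: "affine_mean m" "m (indicator E) = upper_density F E"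
    "\<And>S. m (indicator S) \<le> upper_density F S"
    using affine_mean_of_density[OF \<open>double_Folner F\<close>, of E] by metis
  interpret affine_mean_folner m F
    using m(1) \<open>double_Folner F\<close> \<open>infinite UNIV\<close>
    by (simp add: affine_mean_folner_def affine_mean_folner_axioms_def)
  define d where "d = upper_density F E"
  let ?f = "indicator E :: 'a \<Rightarrow> real"
  have bf: "bdd ?f"
    by (rule bddI[of _ 1]) (auto simp: indicator_def)
  have char: "CHAR('a) = 0 \<or> degree p < CHAR('a)"
    using \<open>admissible p\<close> prime_gt_0_nat[of "CHAR('a)"] by (auto simp: admissible_def)
  define \<phi> where "\<phi> u = m (\<lambda>v. ?f (v / u + poly p u) * ?f v)" for u
  have \<phi>_le: "\<phi> u \<le> upper_density F (set_shift E (poly p u) \<inter> set_quot E u)" if u: "u \<noteq> 0" for u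
  proof -
    have "\<phi> u = m (\<lambda>v. ?f (v + poly p u) * ?f (u * v))"
      using m_dilate[of "\<lambda>v. ?f (v / u + poly p u) * ?f v" u] u
      by (simp add: \<phi>_def bdd_intros bf bdd_comp[OF bf])
    also have "\<dots> = m (indicator (set_shift E (poly p u) \<inter> set_quot E u))"
      by (rule arg_cong[of _ _ m]) (auto simp: set_shift_def set_quot_def indicator_def)
    also have "\<dots> \<le> upper_density F (set_shift E (poly p u) \<inter> set_quot E u)"
      by (rule m(3))
    finally show ?thesis .
  qed
  have \<phi>1: "\<phi> u \<le> 1" for u
    using m_abs_le[of "\<lambda>v. ?f (v / u + poly p u) * ?f v" 1] by (auto simp: \<phi>_def indicator_def abs_le_iff)
  \<comment> \<open>The weight \<open>1 + \<epsilon>\<close> instead of \<open>1\<close> allows for \<open>d\<^sup>2 - \<epsilon>\<close> to be negative.\<close>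
  have bound: "\<phi> u \<le> (d\<^sup>2 - \<epsilon>) + (1 + \<epsilon>) * indicator R u + (if u = 0 then 1 + \<epsilon> else 0)" for u
  proof -
    have "\<phi> u \<le> d\<^sup>2 + 1"
      using \<phi>1[of u] zero_le_power2[of d] by linarith
    moreover have "\<phi> u \<le> d\<^sup>2 - \<epsilon> \<or> u \<in> R \<or> u = 0"
      using \<phi>_le[of u] by (auto simp: R_def d_def)
    ultimately show ?thesis
      using \<open>\<epsilon> > 0\<close> by (cases "u \<in> R") (auto simp: R_def)
  qed
  have "\<forall>\<^sub>F N in sequentially. d\<^sup>2 - \<epsilon> / 4 \<le> avg (F N) \<phi>"
    using average_lower_bound[of ?f p "\<epsilon> / 4"] char \<open>degree p > 0\<close> \<open>\<epsilon> > 0\<close> m(2)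
    by (auto simp: indicator_def \<phi>_def[abs_def] d_def)
  moreover have "\<forall>\<^sub>F N in sequentially. avg (F N) (\<lambda>u. if u = 0 then 1 + \<epsilon> else 0) < \<epsilon> / 4"
    by (rule order_tendstoD(2)[OF avg_indicator_zero]) (use \<open>\<epsilon> > 0\<close> in simp)
  ultimately have "\<forall>\<^sub>F N in sequentially.
      \<epsilon> / (2 * (1 + \<epsilon>)) \<le> real (card (R \<inter> F N)) / real (card (F N))"
  proof eventually_elim
    case (elim N)
    have "avg (F N) \<phi> \<le> avg (F N) (\<lambda>u. (d\<^sup>2 - \<epsilon>) + (1 + \<epsilon>) * indicator R u + (if u = 0 then 1 + \<epsilon> else 0))"
      by (intro avg_mono bound)
    also have "\<dots> = (d\<^sup>2 - \<epsilon>) + (1 + \<epsilon>) * avg (F N) (indicator R) + avg (F N) (\<lambda>u. if u = 0 then 1 + \<epsilon> else 0)"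
      unfolding avg_add by (simp add: avg_scale avg_const)
    finally have "\<epsilon> / 2 \<le> (1 + \<epsilon>) * avg (F N) (indicator R)"
      using elim by linarith
    then show ?case
      using \<open>\<epsilon> > 0\<close> by (simp add: avg_indicator[symmetric] field_simps)
  qed
  then have "ereal (\<epsilon> / (2 * (1 + \<epsilon>))) \<le> liminf (\<lambda>N. ereal (real (card (R \<inter> F N)) / real (card (F N))))"
    by (intro Liminf_bounded) simp
  also have "\<dots> = ereal (lower_density F R)"
    by (rule ereal_lower_density[symmetric]) simp
  finally have "\<epsilon> / (2 * (1 + \<epsilon>)) \<le> lower_density F R"
    by simp
  moreover have "0 < \<epsilon> / (2 * (1 + \<epsilon>))"
    using \<open>\<epsilon> > 0\<close> by simp
  ultimately show ?thesis
    unfolding R_def by linarith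
qed

end
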